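(* Let $\Omega\subset\mathbb{R}^2$ be a bounded, strictly convex domain with real-analytic boundary $\partial\Omega$. Then $\Omega$ has at most two focal points of the second kind. If there are exactly two, then $\partial\Omega$ is a non-circular ellipse and the focal points are its foci.
   Context: Let $\gamma:\mathbb{S}^1\to\partial\Omega$ be a unit-speed parametrization of $\partial\Omega$. For $c\in\Omega$ define $\varphi_c:\mathbb{S}^1\to\mathbb{R}$ by $\varphi_c(\xi)=|\gamma(\xi)-c|+|\gamma(\xi)-\gamma(\xi')|+|\gamma(\xi')-c|$, where $\gamma(\xi')\in\partial\Omega$ is the next point hit when the segment from $c$ to $\gamma(\xi)$ is elastically reflected at $\gamma(\xi)$ (equal angles with the tangent line) into the segment $\gamma(\xi)\gamma(\xi')$. The point $c$ is a focal point for $\Omega$ if $\varphi_c$ is constant in $\xi$. A point $c\in\Omega$ is of the first kind if the distance function $\xi\mapsto|\gamma(\xi)-c|$ has at least one pair of strict local extremals (minima or maxima) corresponding to boundary points that are not antipodal; all other points of $\Omega$ are of the second kind. Two boundary points are antipodal (with respect to $c$) if $c$ lies on the segment joining them. A focal point of the second kind is a point that is both focal and of the second kind. *)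

theory Defs
  imports "HOL-Analysis.Analysis"
begin

type_synonym plane = "real ^ 2"

definition real_analytic :: "(real \<Rightarrow> 'a::real_normed_vector) \<Rightarrow> bool" where
  "real_analytic f \<longleftrightarrow>
     (\<forall>t. \<exists>a. \<exists>r>0. \<forall>s. \<bar>s - t\<bar> < r \<longrightarrow> (\<lambda>n. (s - t) ^ n *\<^sub>R a n) sums f s)"

definition planar_domain :: "plane set \<Rightarrow> bool" where
  "planar_domain \<Omega> \<longleftrightarrow> open \<Omega> \<and> connected \<Omega> \<and> \<Omega> \<noteq> {}"

definition strictly_convex :: "plane set \<Rightarrow> bool" where
  "strictly_convex S \<longleftrightarrow>
     (\<forall>x\<in>closure S. \<forall>y\<in>closure S. x \<noteq> y \<longrightarrow> open_segment x y \<subseteq> interior S)"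

text \<open>The circle is modelled as the reals modulo the perimeter \<open>L\<close>; the parametrization is
  lifted to an \<open>L\<close>-periodic function. A boundary is real-analytic iff it has such a
  parametrization (arc length is an analytic parameter of an analytic regular curve).\<close>

definition analytic_unit_speed_boundary ::
    "plane set \<Rightarrow> real \<Rightarrow> (real \<Rightarrow> plane) \<Rightarrow> bool" where
  "analytic_unit_speed_boundary \<Omega> L \<gamma> \<longleftrightarrow>
     L > 0 \<and> (\<forall>t. \<gamma> (t + L) = \<gamma> t) \<and>
     bij_betw \<gamma> {0..<L} (frontier \<Omega>) \<and>
     real_analytic \<gamma> \<and>
     (\<forall>t. \<gamma> differentiable (at t) \<and> norm (vector_derivative \<gamma> (at t)) = 1)"

text \<open>With \<open>v\<close> the incoming direction and \<open>T\<close> the unit tangent, the reflected direction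
  \<open>2 (v \<bullet> T) T - v\<close> keeps the tangential component of \<open>v\<close> and reverses its normal
  component.\<close>

definition reflected_direction :: "(real \<Rightarrow> plane) \<Rightarrow> plane \<Rightarrow> real \<Rightarrow> plane" where
  "reflected_direction \<gamma> c \<xi> =
     (let v = \<gamma> \<xi> - c; T = vector_derivative \<gamma> (at \<xi>)
      in (2 * (v \<bullet> T)) *\<^sub>R T - v)"

text \<open>For \<open>c\<close> in a bounded strictly convex domain the reflected direction points strictly
  into the domain, so the description below determines exactly one point.\<close>

definition next_hit :: "plane set \<Rightarrow> (real \<Rightarrow> plane) \<Rightarrow> plane \<Rightarrow> real \<Rightarrow> plane" where
  "next_hit \<Omega> \<gamma> c \<xi> =
     (THE q. q \<in> frontier \<Omega> \<and>
        (\<exists>s>0. q = \<gamma> \<xi> + s *\<^sub>R reflected_direction \<gamma> c \<xi> \<and>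
          (\<forall>r. 0 < r \<and> r < s \<longrightarrow>
             \<gamma> \<xi> + r *\<^sub>R reflected_direction \<gamma> c \<xi> \<notin> frontier \<Omega>)))"

definition phi :: "plane set \<Rightarrow> (real \<Rightarrow> plane) \<Rightarrow> plane \<Rightarrow> real \<Rightarrow> real" where
  "phi \<Omega> \<gamma> c \<xi> =
     (let q = next_hit \<Omega> \<gamma> c \<xi>
      in dist (\<gamma> \<xi>) c + dist (\<gamma> \<xi>) q + dist q c)"

definition focal_point :: "plane set \<Rightarrow> (real \<Rightarrow> plane) \<Rightarrow> plane \<Rightarrow> bool" where
  "focal_point \<Omega> \<gamma> c \<longleftrightarrow> c \<in> \<Omega> \<and> phi \<Omega> \<gamma> c constant_on UNIV"

definition strict_local_extremal :: "(real \<Rightarrow> real) \<Rightarrow> real \<Rightarrow> bool" where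
  "strict_local_extremal f \<xi> \<longleftrightarrow>
     (\<forall>\<^sub>F \<eta> in at \<xi>. f \<xi> < f \<eta>) \<or> (\<forall>\<^sub>F \<eta> in at \<xi>. f \<eta> < f \<xi>)"

definition antipodal :: "plane \<Rightarrow> plane \<Rightarrow> plane \<Rightarrow> bool" where
  "antipodal c p q \<longleftrightarrow> c \<in> closed_segment p q"

text \<open>The requirement that the two boundary points differ is essential: a single extremal,
  or two of its lifts to the reals, does not form a pair. The two extremals may be of the
  same or of different type.\<close>

definition first_kind :: "plane set \<Rightarrow> (real \<Rightarrow> plane) \<Rightarrow> plane \<Rightarrow> bool" where
  "first_kind \<Omega> \<gamma> c \<longleftrightarrow> c \<in> \<Omega> \<and>
     (\<exists>\<xi> \<eta>. \<gamma> \<xi> \<noteq> \<gamma> \<eta> \<and>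
        strict_local_extremal (\<lambda>t. dist (\<gamma> t) c) \<xi> \<and>
        strict_local_extremal (\<lambda>t. dist (\<gamma> t) c) \<eta> \<and>
        \<not> antipodal c (\<gamma> \<xi>) (\<gamma> \<eta>))"

definition second_kind :: "plane set \<Rightarrow> (real \<Rightarrow> plane) \<Rightarrow> plane \<Rightarrow> bool" where
  "second_kind \<Omega> \<gamma> c \<longleftrightarrow> c \<in> \<Omega> \<and> \<not> first_kind \<Omega> \<gamma> c"

definition focal_points_second_kind :: "plane set \<Rightarrow> (real \<Rightarrow> plane) \<Rightarrow> plane set" where
  "focal_points_second_kind \<Omega> \<gamma> = {c. focal_point \<Omega> \<gamma> c \<and> second_kind \<Omega> \<gamma> c}"

definition ellipse_with_foci :: "plane set \<Rightarrow> plane \<Rightarrow> plane \<Rightarrow> bool" where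
  "ellipse_with_foci E f1 f2 \<longleftrightarrow>
     (\<exists>s > dist f1 f2. E = {p. dist p f1 + dist p f2 = s})"

definition circular :: "plane set \<Rightarrow> bool" where
  "circular E \<longleftrightarrow> (\<exists>z r. E = sphere z r)"

end

theory Submission
  imports Defs "HOL-Complex_Analysis.Cauchy_Integral_Formula"
begin

text \<open>
  Any two distinct focal points are the foci of an ellipse that carries the whole boundary; the theorem
  follows, because an ellipse determines its second focus from its first and is not a circle when its
  foci differ.

  For a point \<open>c\<close> of the domain, consider the length
  \<open>\<bar>p - c\<bar> + \<bar>p - q\<bar> + \<bar>q - c\<bar>\<close> of the closed path
  \<open>c \<rightarrow> p \<rightarrow> q \<rightarrow> c\<close> with \<open>p\<close> and
  \<open>q\<close> on the boundary. A longest path obeys the law of reflection at \<open>p\<close>, so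
  that \<open>q\<close> is the next point hit and the length is a value of \<open>phi\<close>. If
  \<open>c\<close> is focal, then \<open>phi\<close> is constant and hence equal to the maximum: every
  boundary point \<open>p\<close> has a partner \<open>q\<close> for which the path is a longest one
  (\<open>focal_point_max_pairing\<close>). In particular the law of reflection holds at
  \<open>q\<close> too.

  Let \<open>c\<^sub>1\<close> and \<open>c\<^sub>2\<close> be distinct focal points, and let
  \<open>x\<close> be a point where the line through them meets the boundary. Both points send the same
  ray to \<open>x\<close>, so \<open>x\<close> has the same partner \<open>y\<close> for both;
  reflection at \<open>y\<close> returns to both, so \<open>y\<close> lies on the line as well, and the
  boundary is perpendicular to the line at \<open>x\<close> and \<open>y\<close>
  (\<open>focal_axis\<close>). With \<open>\<ell> = \<bar>x - y\<bar>\<close>, both maxima are equal to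
  \<open>2 \<ell>\<close>.

  Put \<open>g(p) = \<bar>p - c\<^sub>1\<bar> + \<bar>p - c\<^sub>2\<bar>\<close>. If \<open>q\<close>
  is a partner of \<open>p\<close> for one of the focal points, then the triangle inequality at the
  other one gives \<open>g(p) + g(q) \<ge> 2 \<ell>\<close>. If instead the chord from \<open>p\<close>
  to \<open>q\<close> passes through one of the focal points, then \<open>g(p) + g(q)\<close> is the
  length of a path from the other one, so it is at most \<open>2 \<ell>\<close>. A move of the first
  sort followed by one of the second therefore does not increase \<open>g\<close>, and the opposite
  order does not decrease it. Near \<open>x\<close> each of these compositions can be chosen to be a
  contraction towards \<open>x\<close>, for the following reason. Write
  \<open>r\<^sub>i = \<bar>y - c\<^sub>i\<bar> / \<bar>x - c\<^sub>i\<bar>\<close>, and let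
  \<open>x\<close> be the endpoint nearer to \<open>c\<^sub>2\<close>, so that
  \<open>r\<^sub>1 < r\<^sub>2\<close>. The chord through \<open>c\<^sub>i\<close> moves points near
  \<open>x\<close> to points near \<open>y\<close> with slope \<open>\<plusminus>r\<^sub>i\<close>. The
  partner maps have slopes \<open>\<plusminus>(A - r\<^sub>i)\<close> from \<open>x\<close> to
  \<open>y\<close> and \<open>\<plusminus>(B - 1 / r\<^sub>i)\<close> from \<open>y\<close> to
  \<open>x\<close>, where \<open>A\<close> and \<open>B\<close> depend only on \<open>\<ell>\<close> and the
  curvatures at \<open>x\<close> and \<open>y\<close>. These slopes are reciprocal,
  \<open>(A - r\<^sub>i) (B - 1 / r\<^sub>i) = 1\<close> for both \<open>i\<close>, and maximality gives
  \<open>A \<ge> r\<^sub>i\<close>; this forces \<open>A = r\<^sub>1 + r\<^sub>2\<close>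
  (\<open>two_slopes_determined\<close>), so that the partner maps of \<open>c\<^sub>1\<close> and
  \<open>c\<^sub>2\<close> have slopes \<open>\<plusminus>r\<^sub>2\<close> and
  \<open>\<plusminus>r\<^sub>1\<close>. Combining the partner for \<open>c\<^sub>2\<close> with the
  chord through \<open>c\<^sub>2\<close>, or the chord through \<open>c\<^sub>1\<close> with the partner
  for \<open>c\<^sub>1\<close>, gives slope \<open>r\<^sub>1 / r\<^sub>2 < 1\<close>.

  Iterating the two contractions gives \<open>g \<ge> g(x)\<close> and \<open>g \<le> g(x)\<close> near
  \<open>x\<close>, so \<open>g\<close> is constant there (\<open>focal_sum_locally_constant\<close>).
  By analyticity the whole boundary lies on the ellipse \<open>g = g(x)\<close>, and a ray argument
  shows that it is all of it (\<open>focal_points_ellipse\<close>).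
\<close>

section \<open>Real-analytic functions of one variable\<close>

lemma real_analytic_iff:
  fixes f :: "real \<Rightarrow> real"
  shows "real_analytic f \<longleftrightarrow>
    (\<forall>t. \<exists>a. \<exists>r>0. \<forall>h. \<bar>h\<bar> < r \<longrightarrow> (\<lambda>n. a n * h ^ n) sums f (t + h))"
proof -
  have "(\<forall>s. \<bar>s - t\<bar> < r \<longrightarrow> (\<lambda>n. (s - t) ^ n *\<^sub>R a n) sums f s) \<longleftrightarrow>
      (\<forall>h. \<bar>h\<bar> < r \<longrightarrow> (\<lambda>n. a n * h ^ n) sums f (t + h))"
    (is "?L = ?R") for a t r
  proof
    assume L: ?L
    show ?R
      using L[rule_format, of "t + h" for h] by (simp add: mult.commute)
  next
    assume R: ?R
    show ?L
      using R[rule_format, of "s - t" for s] by (simp add: mult.commute)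
  qed
  then show ?thesis
    by (simp add: real_analytic_def)
qed

lemma real_analytic_component:
  fixes f :: "real \<Rightarrow> real ^ 'n"
  assumes "real_analytic f"
  shows "real_analytic (\<lambda>t. f t $ i)"
  unfolding real_analytic_def
proof
  fix t
  obtain a r where "r > 0" and a: "\<And>s. \<bar>s - t\<bar> < r \<Longrightarrow> (\<lambda>n. (s - t) ^ n *\<^sub>R a n) sums f s"
    using assms unfolding real_analytic_def by blast
  have "(\<lambda>n. (s - t) ^ n *\<^sub>R (a n $ i)) sums (f s $ i)" if "\<bar>s - t\<bar> < r" for s
    using bounded_linear.sums[OF bounded_linear_vec_nth a[OF that], of i] by simp
  with \<open>r > 0\<close> show "\<exists>a. \<exists>r>0. \<forall>s. \<bar>s - t\<bar> < r \<longrightarrow> (\<lambda>n. (s - t) ^ n *\<^sub>R a n) sums (f s $ i)"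
    by (intro exI[of _ "\<lambda>n. a n $ i"]) blast
qed

lemma real_analytic_const: "real_analytic (\<lambda>_. c :: real)"
  unfolding real_analytic_iff
proof
  fix t
  have "(\<lambda>n. (if n = 0 then c else 0) * h ^ n) sums c" for h
    using sums_single[of 0 "\<lambda>n. c"] by (rule back_subst[of "\<lambda>f. f sums c"]) auto
  then show "\<exists>a. \<exists>r>0. \<forall>h. \<bar>h\<bar> < r \<longrightarrow> (\<lambda>n. a n * h ^ n) sums c"
    by (intro exI[of _ "\<lambda>n. if n = 0 then c else 0"] exI[of _ 1]) simp
qed

lemma real_analytic_add:
  fixes f g :: "real \<Rightarrow> real"
  assumes "real_analytic f" "real_analytic g"
  shows "real_analytic (\<lambda>t. f t + g t)"
  unfolding real_analytic_iff
proof
  fix t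
  obtain a r b q where "r > 0" "q > 0"
    and a: "\<And>h. \<bar>h\<bar> < r \<Longrightarrow> (\<lambda>n. a n * h ^ n) sums f (t + h)"
    and b: "\<And>h. \<bar>h\<bar> < q \<Longrightarrow> (\<lambda>n. b n * h ^ n) sums g (t + h)"
    using assms unfolding real_analytic_iff by metis
  then have "(\<lambda>n. (a n + b n) * h ^ n) sums (f (t + h) + g (t + h))" if "\<bar>h\<bar> < min r q" for h
    using sums_add[OF a b, of h] that by (simp add: distrib_right)
  with \<open>r > 0\<close> \<open>q > 0\<close>
  show "\<exists>a. \<exists>r>0. \<forall>h. \<bar>h\<bar> < r \<longrightarrow> (\<lambda>n. a n * h ^ n) sums (f (t + h) + g (t + h))"
    by (intro exI[of _ "\<lambda>n. a n + b n"] exI[of _ "min r q"]) simp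
qed

lemma real_analytic_mult:
  fixes f g :: "real \<Rightarrow> real"
  assumes "real_analytic f" "real_analytic g"
  shows "real_analytic (\<lambda>t. f t * g t)"
  unfolding real_analytic_iff
proof
  fix t
  obtain a r b q where "r > 0" "q > 0"
    and a: "\<And>h. \<bar>h\<bar> < r \<Longrightarrow> (\<lambda>n. a n * h ^ n) sums f (t + h)"
    and b: "\<And>h. \<bar>h\<bar> < q \<Longrightarrow> (\<lambda>n. b n * h ^ n) sums g (t + h)"
    using assms unfolding real_analytic_iff by metis
  define c where "c n = (\<Sum>i\<le>n. a i * b (n - i))" for n
  have "(\<lambda>n. c n * h ^ n) sums (f (t + h) * g (t + h))" if h: "\<bar>h\<bar> < min r q" for h
  proof -
    define k where "k = (\<bar>h\<bar> + min r q) / 2"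
    have k: "\<bar>h\<bar> < \<bar>k\<bar>" "\<bar>k\<bar> < r" "\<bar>k\<bar> < q"
      using h by (auto simp: k_def)
    have "summable (\<lambda>n. norm (a n * h ^ n))" "summable (\<lambda>n. norm (b n * h ^ n))"
      using powser_insidea[of a k h] powser_insidea[of b k h] a[of k] b[of k] k
      by (auto simp: sums_iff)
    from Cauchy_product_sums[OF this]
    have "(\<lambda>n. \<Sum>i\<le>n. a i * h ^ i * (b (n - i) * h ^ (n - i))) sums (f (t + h) * g (t + h))"
      using a[of h] b[of h] h by (simp add: sums_iff)
    moreover have "(\<Sum>i\<le>n. a i * h ^ i * (b (n - i) * h ^ (n - i))) = c n * h ^ n" for n
      unfolding c_def sum_distrib_right
      by (intro sum.cong refl) (simp add: mult_ac flip: power_add)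
    ultimately show ?thesis
      by simp
  qed
  with \<open>r > 0\<close> \<open>q > 0\<close>
  show "\<exists>a. \<exists>r>0. \<forall>h. \<bar>h\<bar> < r \<longrightarrow> (\<lambda>n. a n * h ^ n) sums (f (t + h) * g (t + h))"
    by (intro exI[of _ c] exI[of _ "min r q"]) simp
qed

lemma real_analytic_derivative:
  fixes f :: "real \<Rightarrow> real"
  assumes "real_analytic f"
  shows "(f has_real_derivative deriv f t) (at t)" and "real_analytic (deriv f)"
proof -
  have main: "\<exists>a. \<exists>r>0. \<forall>h. \<bar>h\<bar> < r \<longrightarrow> (f has_real_derivative deriv f (t + h)) (at (t + h)) \<and>
      (\<lambda>n. a n * h ^ n) sums deriv f (t + h)" for t
  proof -
    obtain a r where "r > 0" and a: "\<And>h. \<bar>h\<bar> < r \<Longrightarrow> (\<lambda>n. a n * h ^ n) sums f (t + h)"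
      using assms unfolding real_analytic_iff by metis
    have "(f has_real_derivative deriv f (t + h)) (at (t + h)) \<and>
        (\<lambda>n. diffs a n * h ^ n) sums deriv f (t + h)" if h: "\<bar>h\<bar> < r" for h
    proof -
      have "((\<lambda>z. \<Sum>n. a n * z ^ n) has_field_derivative (\<Sum>n. diffs a n * h ^ n)) (at h)"
        using a h by (intro termdiffs_strong'[of r]) (auto simp: sums_iff)
      then have "((\<lambda>z. f (t + z)) has_field_derivative (\<Sum>n. diffs a n * h ^ n)) (at h)"
      proof (rule has_field_derivative_transform_within_open[where S = "ball 0 r"])
        show "(\<Sum>n. a n * z ^ n) = f (t + z)" if "z \<in> ball 0 r" for z
          using a[of z] that by (simp add: sums_iff)
      qed (use h in auto)
      then have D: "(f has_field_derivative (\<Sum>n. diffs a n * h ^ n)) (at (t + h))"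
        by (simp add: DERIV_shift add.commute)
      then have D': "(f has_real_derivative deriv f (t + h)) (at (t + h))"
        by (simp add: DERIV_imp_deriv)
      moreover have "(\<lambda>n. diffs a n * h ^ n) sums deriv f (t + h)"
      proof (rule termdiffs_sums_strong[of r])
        show "((\<lambda>z. f (t + z)) has_real_derivative deriv f (t + h)) (at h)"
          using D' by (simp add: DERIV_shift add.commute)
      qed (use a h in auto)
      ultimately show ?thesis ..
    qed
    with \<open>r > 0\<close> show ?thesis
      by blast
  qed
  show "(f has_real_derivative deriv f t) (at t)"
    using main[of t] by (metis abs_zero add_0_right)
  show "real_analytic (deriv f)"
    unfolding real_analytic_iff using main by metis
qed

lemma real_analytic_derivative_differentiable:
  fixes f :: "real \<Rightarrow> real ^ 'n"
  assumes "real_analytic f"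
  shows "(\<lambda>t. vector_derivative f (at t)) differentiable (at t)"
proof -
  define g where "g i t = f t $ i" for i t
  have g: "real_analytic (g i)" for i
    unfolding g_def using assms by (rule real_analytic_component)
  define T where "T t = (\<chi> i. deriv (g i) t)" for t
  define T' where "T' t = (\<chi> i. deriv (deriv (g i)) t)" for t
  have vec: "(F has_vector_derivative F') (at t)"
    if "\<And>i. ((\<lambda>t. F t $ i) has_real_derivative F' $ i) (at t)"
    for F :: "real \<Rightarrow> real ^ 'n" and F' t
  proof -
    have "(F has_derivative (\<lambda>h. h *\<^sub>R F')) (at t)"
      using that
      by (subst has_derivative_componentwise_within) (auto simp: Basis_vec_def inner_axis has_field_derivative_def mult_commute_abs)
    then show ?thesis
      by (simp add: has_vector_derivative_def)
  qed
  have T: "(f has_vector_derivative T t) (at t)" for t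
    using real_analytic_derivative(1)[OF g] by (intro vec) (simp add: T_def flip: g_def)
  then have "vector_derivative f (at t) = T t" for t
    by (rule vector_derivative_at)
  moreover have "(T has_vector_derivative T' t) (at t)"
    using real_analytic_derivative(1)[OF real_analytic_derivative(2)[OF g]]
    by (intro vec) (simp add: T_def T'_def)
  ultimately show ?thesis
    by (auto simp: differentiableI_vector)
qed

text \<open>The set of points near which the function vanishes is open by definition. It is closed
  because at a limit point all coefficients of the power series vanish: otherwise the zeros would be
  isolated there.\<close>

lemma real_analytic_eq_0:
  fixes f :: "real \<Rightarrow> real"
  assumes f: "real_analytic f" and "\<forall>\<^sub>F s in nhds a. f s = 0"
  shows "f t = 0"
proof -
  define Z where "Z = {t. \<forall>\<^sub>F s in nhds t. f s = 0}"
  have "open Z"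
    unfolding Z_def by (rule topological_space_class.openI) (auto simp: eventually_nhds)
  moreover have "closed Z"
    unfolding closed_limpt
  proof (intro allI impI)
    fix t assume lim: "t islimpt Z"
    obtain a r where "r > 0" and a: "\<And>h. \<bar>h\<bar> < r \<Longrightarrow> (\<lambda>n. a n * h ^ n) sums f (t + h)"
      using f unfolding real_analytic_iff by metis
    have zero: "\<exists>z. z \<noteq> t \<and> dist z t < s \<and> f z = 0" if "s > 0" for s
    proof -
      obtain z where "z \<in> Z" "z \<noteq> t" "dist z t < s"
        using lim \<open>s > 0\<close> by (auto simp: islimpt_approachable)
      then show ?thesis
        using eventually_nhds_x_imp_x by (fastforce simp: Z_def)
    qed
    have "isCont f t"
      using real_analytic_derivative(1)[OF f] DERIV_isCont by blast
    have "f t = 0"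
    proof (rule ccontr)
      assume "f t \<noteq> 0"
      then obtain e where "e > 0" "\<And>z. dist t z < e \<Longrightarrow> f z \<noteq> 0"
        using continuous_at_avoid[OF \<open>isCont f t\<close>] by metis
      with zero[of e] show False
        by (auto simp: dist_commute)
    qed
    have "a m = 0" for m
    proof (cases "m = 0")
      case True
      have "(\<lambda>n. a n * 0 ^ n) sums f (t + 0)"
        using a[of 0] \<open>r > 0\<close> by simp
      then have "a 0 = f t"
        by (simp add: powser_sums_zero_iff)
      then show ?thesis
        using True \<open>f t = 0\<close> by simp
    next
      case False
      show ?thesis
      proof (rule ccontr)
        assume "a m \<noteq> 0"
        have pow: "(\<lambda>n. a n * (x - t) ^ n) sums f x" if "norm (x - t) < r" for x
          using a[of "x - t"] that by simp
        then obtain s where "s > 0" and s: "\<And>z. z \<in> cball t s - {t} \<Longrightarrow> f z \<noteq> 0"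
          using powser_0_nonzero[of r t a f m, OF \<open>r > 0\<close> pow \<open>f t = 0\<close> \<open>a m \<noteq> 0\<close>] False
          by blast
        then show False
          using zero[of s] by (auto simp: dist_commute)
      qed
    qed
    then have "f s = 0" if "\<bar>s - t\<bar> < r" for s
      using a[of "s - t"] that by (simp add: sums_iff)
    then show "t \<in> Z"
      using \<open>r > 0\<close> unfolding Z_def
      by (auto simp: eventually_nhds_metric dist_real_def)
  qed
  moreover have "a \<in> Z"
    using assms(2) by (simp add: Z_def)
  ultimately have "Z = UNIV"
    using connected_clopen[of "UNIV :: real set"] connected_UNIV by auto
  then show ?thesis
    using eventually_nhds_x_imp_x[of "\<lambda>s. f s = 0" t] by (auto simp: Z_def)
qed

section \<open>Plane geometry\<close>

lemma planar_lagrange_identity: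
  fixes a b T :: plane
  shows "(a $ 1 * T $ 2 - a $ 2 * T $ 1) * (b $ 1 * T $ 2 - b $ 2 * T $ 1) =
    (a \<bullet> b) * (T \<bullet> T) - (a \<bullet> T) * (b \<bullet> T)"
  by (simp add: inner_vec_def sum_2 algebra_simps)

lemma plane_orthogonal_eq_0:
  fixes a b T :: plane
  assumes "T \<bullet> T = 1" "a \<bullet> T = 0" "b \<bullet> T = 0" "a \<bullet> b = 0"
  shows "a = 0 \<or> b = 0"
proof -
  have "a $ 1 * T $ 2 - a $ 2 * T $ 1 = 0 \<or> b $ 1 * T $ 2 - b $ 2 * T $ 1 = 0"
    using planar_lagrange_identity[of a T b] assms by simp
  then have "a \<bullet> a = 0 \<or> b \<bullet> b = 0"
    using planar_lagrange_identity[of a T a] planar_lagrange_identity[of b T b] assms by auto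
  then show ?thesis
    by simp
qed

text \<open>In the plane a unit vector is determined by its tangential component up to reflection:
  difference and sum of the two candidates are orthogonal to each other, and both are orthogonal to
  \<open>T\<close> after the tangential part is removed, so one of them vanishes.\<close>

lemma plane_eq_or_reflected:
  fixes T u z :: plane
  assumes "norm T = 1" "norm u = 1" "norm z = 1" "T \<bullet> z = T \<bullet> u"
  shows "z = u \<or> z = (2 * (u \<bullet> T)) *\<^sub>R T - u"
proof -
  define p where "p = z - u"
  define q where "q = z + u - (2 * (u \<bullet> T)) *\<^sub>R T"
  have T: "T \<bullet> T = 1" and uz: "u \<bullet> u = 1" "z \<bullet> z = 1"
    using assms by (simp_all add: dot_square_norm)
  have "p \<bullet> T = 0" "q \<bullet> T = 0"
    using assms(4) T by (simp_all add: p_def q_def inner_simps inner_commute)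
  moreover have "p \<bullet> q = 0"
    using assms(4) uz by (simp add: p_def q_def inner_simps inner_commute algebra_simps)
  ultimately have "p = 0 \<or> q = 0"
    using T by (intro plane_orthogonal_eq_0)
  then show ?thesis
    by (auto simp: p_def q_def algebra_simps)
qed

lemma plane_unit_normals_parallel:
  fixes T U w :: plane
  assumes "norm T = 1" "norm U = 1" "T \<bullet> w = 0" "U \<bullet> w = 0" "w \<noteq> 0"
  shows "\<bar>T \<bullet> U\<bar> = 1"
proof -
  define t u where "t = T $ 1 * w $ 2 - T $ 2 * w $ 1" and "u = U $ 1 * w $ 2 - U $ 2 * w $ 1"
  have tt: "t * t = w \<bullet> w" "u * u = w \<bullet> w" and tu: "t * u = (T \<bullet> U) * (w \<bullet> w)"
    unfolding t_def u_def planar_lagrange_identity using assms by (simp_all add: dot_square_norm)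
  have "(t * u)\<^sup>2 = (t * t) * (u * u)"
    by (simp add: power2_eq_square)
  then have "((T \<bullet> U) * (w \<bullet> w))\<^sup>2 = (w \<bullet> w)\<^sup>2"
    unfolding tu tt by (simp add: power2_eq_square)
  then have "(T \<bullet> U)\<^sup>2 = 1"
    using assms(5) by (simp add: power_mult_distrib)
  then show ?thesis
    by (auto simp: power2_eq_1_iff)
qed

lemma norm_sgn_scaleR: "norm x *\<^sub>R sgn x = x"
  by (cases "x = 0") (simp_all add: sgn_div_norm)

lemma has_real_derivative_dist_curve:
  fixes \<gamma> :: "real \<Rightarrow> 'a :: real_inner"
  assumes "(\<gamma> has_vector_derivative T) (at s)" and "\<gamma> s \<noteq> p"
  shows "((\<lambda>x. dist (\<gamma> x) p) has_real_derivative T \<bullet> sgn (\<gamma> s - p)) (at s)"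
proof -
  have "((\<lambda>x. \<gamma> x - p) has_derivative (\<lambda>h. h *\<^sub>R T)) (at s)"
    using assms(1) unfolding has_vector_derivative_def by (auto intro!: derivative_eq_intros)
  moreover have "(norm has_derivative (\<lambda>v. v \<bullet> sgn (\<gamma> s - p))) (at (\<gamma> s - p))"
    using assms(2) by (intro has_derivative_norm) simp
  ultimately have "((\<lambda>x. norm (\<gamma> x - p)) has_derivative (\<lambda>h. (h *\<^sub>R T) \<bullet> sgn (\<gamma> s - p))) (at s)"
    by (rule has_derivative_compose)
  then show ?thesis
    by (simp add: dist_norm has_field_derivative_def inner_commute mult_commute_abs)
qed

section \<open>Chords and rays of an analytic oval\<close>

locale analytic_oval =
  fixes \<Omega> :: "plane set" and L :: real and \<gamma> :: "real \<Rightarrow> plane"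
  assumes planar_domain: "planar_domain \<Omega>"
    and bounded: "bounded \<Omega>"
    and strictly_convex: "strictly_convex \<Omega>"
    and boundary: "analytic_unit_speed_boundary \<Omega> L \<gamma>"
begin

abbreviation T :: "real \<Rightarrow> plane" where
  "T t \<equiv> vector_derivative \<gamma> (at t)"

definition T' :: "real \<Rightarrow> plane" where
  "T' t = vector_derivative T (at t)"

lemma open_domain: "open \<Omega>"
  using planar_domain by (simp add: planar_domain_def)

lemma open_segment_subset:
  "p \<in> closure \<Omega> \<Longrightarrow> q \<in> closure \<Omega> \<Longrightarrow> open_segment p q \<subseteq> \<Omega>"
  using strictly_convex open_domain
  by (cases "p = q") (auto simp: strictly_convex_def interior_open)

lemma convex_domain: "convex \<Omega>"
  unfolding convex_contains_open_segment
  using open_segment_subset closure_subset by blast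

lemma domain_frontier_disjoint: "c \<in> \<Omega> \<Longrightarrow> c \<notin> frontier \<Omega>"
  using open_domain by (simp add: frontier_def interior_open)

lemma frontier_in_closure: "p \<in> frontier \<Omega> \<Longrightarrow> p \<in> closure \<Omega>"
  by (simp add: frontier_def)

lemma domain_in_closure: "p \<in> \<Omega> \<Longrightarrow> p \<in> closure \<Omega>"
  using closure_subset by blast

lemma period_pos: "L > 0" and periodic: "\<gamma> (t + L) = \<gamma> t" and norm_T: "norm (T t) = 1"
  and boundary_bij: "bij_betw \<gamma> {0..<L} (frontier \<Omega>)" and analytic: "real_analytic \<gamma>"
  using boundary by (auto simp: analytic_unit_speed_boundary_def)

lemma curve_derivative: "(\<gamma> has_vector_derivative T t) (at t)"
  and T_derivative: "(T has_vector_derivative T' t) (at t)"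
  using boundary real_analytic_derivative_differentiable[OF analytic]
  by (simp_all add: T'_def analytic_unit_speed_boundary_def flip: vector_derivative_works)

lemma continuous_curve: "continuous_on S \<gamma>"
  using has_vector_derivative_continuous[OF curve_derivative]
  by (intro continuous_at_imp_continuous_on) simp

lemma periodic_int: "\<gamma> (t + of_int k * L) = \<gamma> t"
proof -
  have nat: "\<gamma> (t + of_nat n * L) = \<gamma> t" for n t
  proof (induction n)
    case (Suc n)
    then show ?case
      using periodic[of "t + of_nat n * L"] by (simp add: algebra_simps)
  qed simp
  show ?thesis
  proof (cases k)
    case (nonneg n)
    then show ?thesis using nat by simp
  next
    case (neg n)
    then show ?thesis
      using nat[of "t - of_nat (Suc n) * L" "Suc n"]
      by (simp del: of_nat_Suc add: minus_mult_left[symmetric])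
  qed
qed

lemma representative:
  obtains k :: int where "t + of_int k * L \<in> {0..<L}"
proof
  have "t / L - of_int \<lfloor>t / L\<rfloor> \<in> {0..<1}"
    by simp linarith
  then have "(t / L - of_int \<lfloor>t / L\<rfloor>) * L \<in> {0..<L}"
    using period_pos by auto
  then show "t + of_int (- \<lfloor>t / L\<rfloor>) * L \<in> {0..<L}"
    using period_pos by (simp add: algebra_simps)
qed

lemma curve_in_frontier: "\<gamma> t \<in> frontier \<Omega>"
proof -
  obtain k :: int where "t + of_int k * L \<in> {0..<L}"
    by (rule representative)
  then have "\<gamma> (t + of_int k * L) \<in> frontier \<Omega>"
    by (rule bij_betw_apply[OF boundary_bij])
  then show ?thesis
    by (simp add: periodic_int)
qed

lemma curve_closure: "\<gamma> t \<in> closure \<Omega>"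
  using curve_in_frontier frontier_in_closure by blast

lemma curve_neq: "c \<in> \<Omega> \<Longrightarrow> \<gamma> t \<noteq> c"
  using curve_in_frontier domain_frontier_disjoint by blast

lemma curve_onto:
  assumes "p \<in> frontier \<Omega>"
  obtains t where "\<gamma> t = p" "\<bar>t - b\<bar> \<le> L / 2"
proof -
  obtain s where s: "\<gamma> s = p"
    using assms boundary_bij by (metis bij_betw_imp_surj_on imageE)
  obtain k :: int where "s - b + L / 2 + of_int k * L \<in> {0..<L}"
    by (rule representative)
  then have "\<bar>s + of_int k * L - b\<bar> \<le> L / 2"
    unfolding abs_le_iff by auto
  then show thesis
    using that[of "s + of_int k * L"] s periodic_int by auto
qed

lemma curve_inj:
  assumes "\<gamma> s = \<gamma> t" "\<bar>s - t\<bar> < L"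
  shows "s = t"
proof -
  obtain k l :: int where k: "s + of_int k * L \<in> {0..<L}" and l: "t + of_int l * L \<in> {0..<L}"
    by (metis representative)
  have "s + of_int k * L = t + of_int l * L"
    using boundary_bij k l assms(1) periodic_int
    by (metis bij_betw_imp_inj_on inj_onD)
  then have eq: "s - t = of_int (l - k) * L"
    by (simp add: algebra_simps)
  then have "\<bar>of_int (l - k)\<bar> * L < 1 * L"
    using assms(2) period_pos by (simp add: abs_mult)
  then have "l = k"
    using period_pos by (simp add: mult_less_cancel_right)
  with eq show ?thesis
    by simp
qed

text \<open>If a ray met the boundary twice, strict convexity would place the nearer of the two points in
  the interior.\<close>

lemma frontier_ray_unique:
  assumes "p \<in> closure \<Omega>" "p + k *\<^sub>R w \<in> frontier \<Omega>" "p + l *\<^sub>R w \<in> frontier \<Omega>"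
    and "k > 0" "l > 0" "w \<noteq> 0"
  shows "k = l"
proof -
  have less: False
    if "0 < k" "k < l" "p + k *\<^sub>R w \<in> frontier \<Omega>" "p + l *\<^sub>R w \<in> frontier \<Omega>" for k l
  proof -
    have "p + k *\<^sub>R w \<in> open_segment p (p + l *\<^sub>R w)"
      using that \<open>w \<noteq> 0\<close> unfolding in_segment
      by (intro conjI exI[of _ "k / l"]) (auto simp: algebra_simps)
    then show False
      using open_segment_subset[of p "p + l *\<^sub>R w"] that assms(1)
        domain_frontier_disjoint frontier_in_closure by blast
  qed
  show ?thesis
    using less[of k l] less[of l k] assms by (cases k l rule: linorder_cases) auto
qed

lemma chord_through:
  assumes "c \<in> \<Omega>" "p \<in> frontier \<Omega>"
  obtains q where "q \<in> frontier \<Omega>" "c \<in> open_segment p q"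
proof -
  have "c \<noteq> p"
    using assms domain_frontier_disjoint by auto
  obtain d where "d > 0" and d: "c + d *\<^sub>R (c - p) \<in> frontier \<Omega>"
    using ray_to_frontier[OF bounded, of c "c - p"] assms(1) open_domain \<open>c \<noteq> p\<close>
    by (auto simp: interior_open)
  have "c \<in> open_segment p (c + d *\<^sub>R (c - p))"
    unfolding in_segment
  proof (intro conjI exI)
    show "c = (1 - 1 / (1 + d)) *\<^sub>R p + (1 / (1 + d)) *\<^sub>R (c + d *\<^sub>R (c - p))"
      using \<open>d > 0\<close> by (simp add: vec_eq_iff divide_simps) (simp add: algebra_simps)
    show "p \<noteq> c + d *\<^sub>R (c - p)"
    proof
      assume "p = c + d *\<^sub>R (c - p)"
      then have "(1 + d) *\<^sub>R (c - p) = 0"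
        by (simp add: algebra_simps)
      with \<open>d > 0\<close> \<open>c \<noteq> p\<close> show False
        by simp
    qed
  qed (use \<open>d > 0\<close> in auto)
  with d show thesis
    using that by blast
qed

text \<open>The tangent line is the only supporting line at a boundary point. A ray that stays outside
  the domain could be separated from it by a supporting line, and then it would not leave to the side of
  the tangent on which \<open>c\<close> lies.\<close>

lemma ray_enters_domain:
  assumes "c \<in> \<Omega>" and normal: "\<And>n. n \<bullet> T s = 0 \<Longrightarrow> n \<bullet> w = n \<bullet> (c - \<gamma> s)"
  obtains r where "r > 0" "\<gamma> s + r *\<^sub>R w \<in> \<Omega>"
proof (rule ccontr)
  assume "\<not> thesis"
  with that have out: "\<gamma> s + r *\<^sub>R w \<notin> \<Omega>" if "r > 0" for r
    using that by blast
  define R where "R = (\<lambda>r. \<gamma> s + r *\<^sub>R w) ` {0<..}"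
  have "convex R"
  proof -
    have "convex ((+) (\<gamma> s) ` (\<lambda>r. r *\<^sub>R w) ` {0::real<..})"
      by (intro convex_translation convex_linear_image linear_scale_left) auto
    then show ?thesis
      by (simp add: R_def image_image)
  qed
  moreover have "\<Omega> \<noteq> {}" "R \<noteq> {}" "\<Omega> \<inter> R = {}"
    using assms(1) out by (auto simp: R_def)
  ultimately obtain a b where "a \<noteq> 0" and a: "\<And>z. z \<in> \<Omega> \<Longrightarrow> a \<bullet> z \<le> b" and b: "\<And>z. z \<in> R \<Longrightarrow> a \<bullet> z \<ge> b"
    using separating_hyperplane_sets[OF convex_domain] by metis
  have closure: "a \<bullet> z \<le> b" if "z \<in> closure \<Omega>" for z
    using closure_minimal[of \<Omega> "{z. a \<bullet> z \<le> b}"] a that closed_halfspace_le by blast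
  have strict: "a \<bullet> c < b"
  proof -
    obtain e where "e > 0" "ball c e \<subseteq> \<Omega>"
      using open_domain assms(1) open_contains_ball by blast
    then have "c + (e / 2 / norm a) *\<^sub>R a \<in> \<Omega>"
      using \<open>a \<noteq> 0\<close> by (auto simp: dist_norm)
    from a[OF this] have "a \<bullet> c + (e / 2 / norm a) * (a \<bullet> a) \<le> b"
      by (simp add: inner_simps)
    moreover have "(e / 2 / norm a) * (a \<bullet> a) > 0"
      using \<open>e > 0\<close> \<open>a \<noteq> 0\<close> by simp
    ultimately show ?thesis
      by linarith
  qed
  have lim: "a \<bullet> \<gamma> s \<ge> b"
  proof (rule tendsto_lowerbound)
    show "((\<lambda>r. a \<bullet> (\<gamma> s + r *\<^sub>R w)) \<longlongrightarrow> a \<bullet> \<gamma> s) (at_right 0)"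
      by (auto intro!: tendsto_eq_intros)
    show "\<forall>\<^sub>F r in at_right 0. b \<le> a \<bullet> (\<gamma> s + r *\<^sub>R w)"
      using b by (intro eventually_at_right_less[THEN eventually_mono]) (auto simp: R_def)
  qed simp
  then have top: "a \<bullet> \<gamma> s = b"
    using closure curve_closure by (intro antisym) auto
  \<comment> \<open>The height \<open>a \<bullet> \<gamma>\<close> is maximal at \<open>s\<close>, so the separating line
      is tangent.\<close>
  have "((\<lambda>x. a \<bullet> \<gamma> x) has_derivative (\<lambda>h. a \<bullet> (h *\<^sub>R T s))) (at s)"
    using curve_derivative[of s] unfolding has_vector_derivative_def
    by (rule has_derivative_inner_right)
  then have "((\<lambda>x. a \<bullet> \<gamma> x) has_real_derivative a \<bullet> T s) (at s)"
    by (simp add: has_field_derivative_def mult_commute_abs)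
  then have "a \<bullet> T s = 0"
    using DERIV_local_max[of _ _ s 1] closure[OF curve_closure] top by force
  then have "a \<bullet> w < 0"
    using normal[of a] strict top by (simp add: inner_simps)
  moreover have "\<gamma> s + 1 *\<^sub>R w \<in> R"
    unfolding R_def by (rule imageI) simp
  then have "b \<le> a \<bullet> (\<gamma> s + 1 *\<^sub>R w)"
    by (rule b)
  ultimately show False
    using top by (simp add: inner_simps)
qed

lemma next_hit_eqI:
  assumes "\<gamma> s + k *\<^sub>R reflected_direction \<gamma> c s \<in> frontier \<Omega>" "k > 0"
    and "reflected_direction \<gamma> c s \<noteq> 0"
  shows "next_hit \<Omega> \<gamma> c s = \<gamma> s + k *\<^sub>R reflected_direction \<gamma> c s"
proof -
  let ?w = "reflected_direction \<gamma> c s"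
  show ?thesis
    unfolding next_hit_def
  proof (rule the_equality)
    have "\<gamma> s + r *\<^sub>R ?w \<notin> frontier \<Omega>" if "0 < r" "r < k" for r
      using frontier_ray_unique[OF curve_closure[of s], of r ?w k] that assms by auto
    with assms(1,2) show "\<gamma> s + k *\<^sub>R ?w \<in> frontier \<Omega> \<and> (\<exists>l>0. \<gamma> s + k *\<^sub>R ?w = \<gamma> s + l *\<^sub>R ?w \<and>
        (\<forall>r. 0 < r \<and> r < l \<longrightarrow> \<gamma> s + r *\<^sub>R ?w \<notin> frontier \<Omega>))"
      by blast
  next
    fix q
    assume "q \<in> frontier \<Omega> \<and> (\<exists>l>0. q = \<gamma> s + l *\<^sub>R ?w \<and>
        (\<forall>r. 0 < r \<and> r < l \<longrightarrow> \<gamma> s + r *\<^sub>R ?w \<notin> frontier \<Omega>))"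
    then show "q = \<gamma> s + k *\<^sub>R ?w"
      using frontier_ray_unique[OF curve_closure[of s] _ assms(1), of _] assms by blast
  qed
qed

lemma reflected_direction_neq_0:
  assumes "c \<in> \<Omega>"
  shows "reflected_direction \<gamma> c s \<noteq> 0"
proof
  let ?v = "\<gamma> s - c"
  assume "reflected_direction \<gamma> c s = 0"
  then have v: "?v = (2 * (?v \<bullet> T s)) *\<^sub>R T s"
    by (simp add: reflected_direction_def Let_def)
  have "T s \<bullet> T s = 1"
    by (simp add: dot_square_norm norm_T)
  then have "?v \<bullet> T s = 2 * (?v \<bullet> T s)"
    using arg_cong[OF v, of "\<lambda>x. x \<bullet> T s"] by simp
  with v have "?v = 0"
    by simp
  then show False
    using curve_neq[OF assms, of s] by simp
qed

lemma next_hit_in_frontier: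
  assumes "c \<in> \<Omega>"
  shows "next_hit \<Omega> \<gamma> c s \<in> frontier \<Omega>"
proof -
  let ?w = "reflected_direction \<gamma> c s"
  have "n \<bullet> ?w = n \<bullet> (c - \<gamma> s)" if "n \<bullet> T s = 0" for n
    using that by (simp add: reflected_direction_def Let_def inner_simps)
  then obtain r where r: "r > 0" "\<gamma> s + r *\<^sub>R ?w \<in> \<Omega>"
    using ray_enters_domain[OF assms] by blast
  obtain d where d: "d > 0" "\<gamma> s + r *\<^sub>R ?w + d *\<^sub>R ?w \<in> frontier \<Omega>"
    using ray_to_frontier[OF bounded, of "\<gamma> s + r *\<^sub>R ?w" ?w] r(2) open_domain
      reflected_direction_neq_0[OF assms]
    by (metis interior_open)
  then have "\<gamma> s + (r + d) *\<^sub>R ?w \<in> frontier \<Omega>"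
    by (simp add: algebra_simps)
  then show ?thesis
    using next_hit_eqI[of s "r + d" c] r d reflected_direction_neq_0[OF assms] by simp
qed

section \<open>Focal points and longest paths\<close>

text \<open>For \<open>\<sigma> = 1\<close> this is the length of the closed path
  \<open>c \<rightarrow> \<gamma> s \<rightarrow> \<gamma> t \<rightarrow> c\<close>. For
  \<open>\<sigma> = - 1\<close> it is minus the excess of the detour from \<open>\<gamma> s\<close> to
  \<open>\<gamma> t\<close> over \<open>c\<close>, so its maximum \<open>0\<close> is attained exactly
  for the chords through \<open>c\<close>. Longest paths and chords through \<open>c\<close> thus
  satisfy the same kind of critical equation, and their dependence on the first endpoint is studied for
  both at once.\<close>

definition path_length :: "real \<Rightarrow> plane \<Rightarrow> real \<Rightarrow> real \<Rightarrow> real" where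
  "path_length \<sigma> c s t = \<sigma> * (dist (\<gamma> s) c + dist (\<gamma> t) c) + dist (\<gamma> s) (\<gamma> t)"

text \<open>Every boundary point has a partner for which the path attains the maximum \<open>E\<close>.
  The last conjunct keeps partners apart, so that the distance between them is differentiable.\<close>

definition max_pairing :: "real \<Rightarrow> plane \<Rightarrow> real \<Rightarrow> bool" where
  "max_pairing \<sigma> c E \<longleftrightarrow> (\<forall>s t. path_length \<sigma> c s t \<le> E) \<and>
     (\<forall>s. \<exists>t. path_length \<sigma> c s t = E) \<and> (\<forall>s. path_length \<sigma> c s s < E)"

lemma path_length_commute: "path_length \<sigma> c s t = path_length \<sigma> c t s"
  by (simp add: path_length_def dist_commute)

lemma path_length_cong: "\<gamma> t = \<gamma> t' \<Longrightarrow> path_length \<sigma> c s t = path_length \<sigma> c s t'"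
  by (simp add: path_length_def)

lemma max_pairing_neq: "max_pairing \<sigma> c E \<Longrightarrow> path_length \<sigma> c s t = E \<Longrightarrow> \<gamma> s \<noteq> \<gamma> t"
  unfolding max_pairing_def by (metis less_irrefl path_length_cong)

lemma continuous_path_length: "continuous_on S (\<lambda>(s, t). path_length \<sigma> c s t)"
  unfolding path_length_def split_beta
  by (intro continuous_intros continuous_on_compose2[OF continuous_curve[of UNIV]]) auto

lemma path_length_derivative:
  assumes "c \<in> \<Omega>" "\<gamma> s \<noteq> \<gamma> t"
  shows "((\<lambda>x. path_length \<sigma> c x t) has_real_derivative
    T s \<bullet> (\<sigma> *\<^sub>R sgn (\<gamma> s - c) + sgn (\<gamma> s - \<gamma> t))) (at s)"
proof -
  have "((\<lambda>x. path_length \<sigma> c x t) has_real_derivative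
      \<sigma> * (T s \<bullet> sgn (\<gamma> s - c) + 0) + T s \<bullet> sgn (\<gamma> s - \<gamma> t)) (at s)"
    unfolding path_length_def using assms curve_neq
    by (intro DERIV_add DERIV_cmult has_real_derivative_dist_curve curve_derivative DERIV_const) auto
  then show ?thesis
    by (simp add: inner_simps)
qed

lemma path_length_critical:
  assumes "c \<in> \<Omega>" "\<And>x. path_length \<sigma> c x t \<le> path_length \<sigma> c s t" "\<gamma> s \<noteq> \<gamma> t"
  shows "T s \<bullet> (\<sigma> *\<^sub>R sgn (\<gamma> s - c) + sgn (\<gamma> s - \<gamma> t)) = 0"
  using DERIV_local_max[OF path_length_derivative[OF assms(1,3)], of 1] assms(2) by simp

text \<open>At a longest path the derivative in the first endpoint vanishes, so the incoming and the
  outgoing direction have the same tangential component. They do not coincide, since otherwise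
  \<open>\<gamma> s\<close> would lie in the open segment from \<open>c\<close> to
  \<open>\<gamma> t\<close>, which is interior.\<close>

lemma longest_path_reflects:
  assumes "c \<in> \<Omega>" and max: "\<And>x. path_length 1 c x t \<le> path_length 1 c s t"
    and "\<gamma> s \<noteq> \<gamma> t"
  shows "sgn (\<gamma> t - \<gamma> s) = (2 * (sgn (\<gamma> s - c) \<bullet> T s)) *\<^sub>R T s - sgn (\<gamma> s - c)"
proof -
  let ?u = "sgn (\<gamma> s - c)" and ?z = "sgn (\<gamma> t - \<gamma> s)"
  have "?z = - sgn (\<gamma> s - \<gamma> t)"
    by (metis minus_diff_eq sgn_minus)
  then have "T s \<bullet> ?z = T s \<bullet> ?u"
    using path_length_critical[OF assms] by (simp add: inner_simps)
  then have "?z = ?u \<or> ?z = (2 * (?u \<bullet> T s)) *\<^sub>R T s - ?u"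
    using assms curve_neq norm_T by (intro plane_eq_or_reflected) (auto simp: norm_sgn)
  moreover have "?z \<noteq> ?u"
  proof
    assume "?z = ?u"
    then have "norm (\<gamma> s - c) *\<^sub>R (\<gamma> t - \<gamma> s) = norm (\<gamma> t - \<gamma> s) *\<^sub>R (\<gamma> s - c)"
      by (metis norm_sgn_scaleR scaleR_left_commute)
    then have "between (c, \<gamma> t) (\<gamma> s)"
      by (simp add: between_norm)
    then have "\<gamma> s \<in> open_segment c (\<gamma> t)"
      using assms(3) curve_neq[OF assms(1)] by (auto simp: between_mem_segment open_segment_def)
    then show False
      using open_segment_subset[OF domain_in_closure[OF assms(1)] curve_closure] curve_in_frontier
        domain_frontier_disjoint by blast
  qed
  ultimately show ?thesis
    by simp
qed

lemma longest_path_next_hit: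
  assumes "c \<in> \<Omega>" "\<And>x. path_length 1 c x t \<le> path_length 1 c s t" "\<gamma> s \<noteq> \<gamma> t"
  shows "next_hit \<Omega> \<gamma> c s = \<gamma> t"
proof -
  define k where "k = norm (\<gamma> t - \<gamma> s) / norm (\<gamma> s - c)"
  have "k > 0"
    using assms curve_neq by (simp add: k_def)
  have "\<gamma> t - \<gamma> s = norm (\<gamma> t - \<gamma> s) *\<^sub>R sgn (\<gamma> t - \<gamma> s)"
    by (simp add: norm_sgn_scaleR)
  also have "\<dots> = k *\<^sub>R reflected_direction \<gamma> c s"
  proof -
    have "a *\<^sub>R ((2 * (sgn v \<bullet> T s)) *\<^sub>R T s - sgn v) = (a / norm v) *\<^sub>R ((2 * (v \<bullet> T s)) *\<^sub>R T s - v)"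
      for a and v :: plane
      by (simp add: sgn_div_norm scaleR_diff_right divide_inverse mult_ac)
    then show ?thesis
      by (simp add: longest_path_reflects[OF assms] k_def reflected_direction_def Let_def)
  qed
  finally have eq: "\<gamma> t = \<gamma> s + k *\<^sub>R reflected_direction \<gamma> c s"
    by (simp add: algebra_simps)
  with next_hit_eqI[of s k c] show ?thesis
    using curve_in_frontier[of t] \<open>k > 0\<close> reflected_direction_neq_0[OF assms(1)] by simp
qed

text \<open>A longest path exists by compactness, and its length is the value of \<open>phi\<close> at
  its first endpoint. For a focal point that value is attained from every starting point.\<close>

lemma focal_point_max_pairing:
  assumes "focal_point \<Omega> \<gamma> c"
  obtains E where "max_pairing 1 c E"
proof -
  have c: "c \<in> \<Omega>" and const: "\<And>s t. phi \<Omega> \<gamma> c s = phi \<Omega> \<gamma> c t"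
    using assms by (auto simp: focal_point_def constant_on_def)
  have "compact ({0..L} \<times> {0..L})" "{0..L} \<times> {0..L} \<noteq> {}"
    using period_pos by (auto intro: compact_Times)
  then obtain s t where st: "\<And>x y. x \<in> {0..L} \<Longrightarrow> y \<in> {0..L} \<Longrightarrow> path_length 1 c x y \<le> path_length 1 c s t"
    using continuous_attains_sup[of "{0..L} \<times> {0..L}", OF _ _ continuous_path_length[of _ 1 c]]
    by (auto simp: Ball_def)
  define E where "E = path_length 1 c s t"
  have le: "path_length 1 c x y \<le> E" for x y
  proof -
    obtain x' y' where "\<gamma> x' = \<gamma> x" "\<bar>x' - L / 2\<bar> \<le> L / 2" "\<gamma> y' = \<gamma> y" "\<bar>y' - L / 2\<bar> \<le> L / 2"
      by (metis curve_onto curve_in_frontier)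
    then show ?thesis
      using st[of x' y'] unfolding E_def path_length_def abs_le_iff by auto
  qed
  \<comment> \<open>The chord from \<open>\<gamma> x\<close> through \<open>c\<close> gives a longer path than the
      degenerate one.\<close>
  have diag: "path_length 1 c x x < E" for x
  proof -
    obtain q where q: "q \<in> frontier \<Omega>" "c \<in> open_segment (\<gamma> x) q"
      using chord_through[OF c curve_in_frontier] by blast
    obtain y where y: "\<gamma> y = q"
      using curve_onto[OF q(1)] by blast
    have "dist (\<gamma> x) (\<gamma> y) = dist (\<gamma> x) c + dist c (\<gamma> y)"
      using q(2) y by (simp add: between[symmetric] between_mem_segment open_segment_def)
    then have "path_length 1 c x y = 2 * (dist (\<gamma> x) c + dist (\<gamma> y) c)"
      by (simp add: path_length_def dist_commute)
    then have "path_length 1 c x x < path_length 1 c x y"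
      using curve_neq[OF c, of y] by (simp add: path_length_def[of _ _ x x])
    then show ?thesis
      using le[of x y] by simp
  qed
  have neq: "\<gamma> s \<noteq> \<gamma> t"
    using diag[of s] by (auto simp: E_def path_length_def)
  have "next_hit \<Omega> \<gamma> c s = \<gamma> t"
    using le neq by (intro longest_path_next_hit c) (auto simp: E_def)
  then have "phi \<Omega> \<gamma> c s = E"
    by (simp add: phi_def E_def path_length_def Let_def)
  moreover have "\<exists>y. path_length 1 c x y = phi \<Omega> \<gamma> c x" for x
  proof -
    obtain y where "\<gamma> y = next_hit \<Omega> \<gamma> c x"
      using curve_onto[OF next_hit_in_frontier[OF c]] by blast
    then show ?thesis
      by (intro exI[of _ y]) (simp add: path_length_def phi_def Let_def)
  qed
  ultimately have "\<exists>y. path_length 1 c x y = E" for x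
    by (metis const)
  then show thesis
    using le diag that[of E] by (auto simp: max_pairing_def)
qed

lemma longest_path_unique:
  assumes "c \<in> \<Omega>" "max_pairing 1 c E" "path_length 1 c s t = E" "path_length 1 c s t' = E"
  shows "\<gamma> t = \<gamma> t'"
  using longest_path_next_hit[OF assms(1), of t s] longest_path_next_hit[OF assms(1), of t' s]
    max_pairing_neq[OF assms(2)] assms(2-4) by (auto simp: max_pairing_def)

lemma detour_eq_0_iff: "path_length (- 1) c s t = 0 \<longleftrightarrow> c \<in> closed_segment (\<gamma> s) (\<gamma> t)"
  by (auto simp: path_length_def between dist_commute simp flip: between_mem_segment)

lemma chord_max_pairing:
  assumes "c \<in> \<Omega>"
  shows "max_pairing (- 1) c 0"
  unfolding max_pairing_def
proof (intro conjI allI)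
  fix s t
  show "path_length (- 1) c s t \<le> 0"
    using dist_triangle2[of "\<gamma> s" "\<gamma> t" c] by (simp add: path_length_def)
  show "path_length (- 1) c s s < 0"
    using curve_neq[OF assms] by (simp add: path_length_def)
  obtain q where q: "q \<in> frontier \<Omega>" "c \<in> open_segment (\<gamma> s) q"
    using chord_through[OF assms curve_in_frontier] by blast
  then show "\<exists>t. path_length (- 1) c s t = 0"
    using curve_onto[OF q(1)] by (metis detour_eq_0_iff open_segment_def DiffD1)
qed

lemma chord_unique:
  assumes "c \<in> \<Omega>" "path_length (- 1) c s t = 0" "path_length (- 1) c s t' = 0"
  shows "\<gamma> t = \<gamma> t'"
proof -
  have ray: "\<exists>k>0. \<gamma> t = \<gamma> s + k *\<^sub>R (c - \<gamma> s)" if "path_length (- 1) c s t = 0" for t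
  proof -
    obtain u where u: "c = (1 - u) *\<^sub>R \<gamma> s + u *\<^sub>R \<gamma> t" "0 \<le> u" "u \<le> 1"
      using \<open>path_length (- 1) c s t = 0\<close> by (auto simp: detour_eq_0_iff in_segment)
    have "u \<noteq> 0"
      using u curve_neq[OF assms(1), of s] by auto
    have "c - \<gamma> s = u *\<^sub>R (\<gamma> t - \<gamma> s)"
      using u(1) by (simp add: algebra_simps)
    then have "\<gamma> t = \<gamma> s + (1 / u) *\<^sub>R (c - \<gamma> s)"
      using \<open>u \<noteq> 0\<close> by simp
    then show ?thesis
      using u \<open>u \<noteq> 0\<close> by (intro exI[of _ "1 / u"]) auto
  qed
  obtain k l where "k > 0" "\<gamma> t = \<gamma> s + k *\<^sub>R (c - \<gamma> s)" "l > 0" "\<gamma> t' = \<gamma> s + l *\<^sub>R (c - \<gamma> s)"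
    using ray assms by metis
  then show ?thesis
    using frontier_ray_unique[OF curve_closure[of s], of k "c - \<gamma> s" l]
      curve_in_frontier[of t] curve_in_frontier[of t'] curve_neq[OF assms(1), of s] by simp
qed

end

section \<open>Partners near an axis\<close>

text \<open>Caratheodory's form of differentiability for curves: the increment is the step times a
  function that is continuous at \<open>0\<close>. It turns the critical equation below into a linear
  relation between the two increments, with continuous coefficients.\<close>

lemma vector_caratheodory:
  assumes "(f has_vector_derivative D) (at a)"
  obtains g where "\<And>h. f (a + h) = f a + h *\<^sub>R g h" "isCont g 0" "g 0 = D"
proof
  let ?g = "\<lambda>h. if h = 0 then D else (f (a + h) - f a) /\<^sub>R h"
  show "f (a + h) = f a + h *\<^sub>R ?g h" for h
    by simp
  have "((\<lambda>h. norm (f (a + h) - f a - h *\<^sub>R D) / norm h) \<longlongrightarrow> 0) (at 0)"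
    using assms unfolding has_vector_derivative_def has_derivative_at by blast
  then have "((\<lambda>h. norm (?g h - D)) \<longlongrightarrow> 0) (at 0)"
  proof (rule Lim_transform_within[of _ _ _ _ 1])
    fix h :: real assume "0 < dist h 0"
    then have "h \<noteq> 0" by simp
    then have "?g h - D = (f (a + h) - f a - h *\<^sub>R D) /\<^sub>R h"
      by (simp add: scaleR_diff_right)
    then show "norm (f (a + h) - f a - h *\<^sub>R D) / norm h = norm (?g h - D)"
      by (simp add: divide_inverse)
  qed simp
  then show "isCont ?g 0"
    unfolding isCont_def by (simp add: tendsto_norm_zero_iff LIM_zero_iff)
  show "?g 0 = D"
    by simp
qed

lemma isCont_eventually_greater:
  fixes f :: "'a::t2_space \<Rightarrow> real"
  assumes "isCont f x" "f x > c"
  shows "\<forall>\<^sub>F z in nhds x. f z > c"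
proof -
  have "(f \<longlongrightarrow> f x) (nhds x)"
    using assms(1) unfolding isCont_def tendsto_at_iff_tendsto_nhds .
  then show ?thesis
    using assms(2) by (rule order_tendstoD(1))
qed

text \<open>Iterating the step produces arguments that tend to \<open>0\<close>, along which
  \<open>G\<close> stays below its initial value.\<close>

lemma contraction_le:
  fixes G :: "real \<Rightarrow> real"
  assumes "isCont G 0" "0 \<le> \<rho>" "\<rho> < 1" "\<bar>u\<bar> < \<delta>"
    and step: "\<And>u. \<bar>u\<bar> < \<delta> \<Longrightarrow> \<exists>w. \<bar>w\<bar> \<le> \<rho> * \<bar>u\<bar> \<and> G w \<le> G u"
  shows "G 0 \<le> G u"
proof -
  have "\<exists>w. \<bar>w\<bar> \<le> \<rho> ^ k * \<bar>u\<bar> \<and> G w \<le> G u" for k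
  proof (induction k)
    case (Suc k)
    then obtain w where w: "\<bar>w\<bar> \<le> \<rho> ^ k * \<bar>u\<bar>" "G w \<le> G u"
      by blast
    moreover have "\<rho> ^ k * \<bar>u\<bar> \<le> \<bar>u\<bar>"
      using assms by (simp add: mult_left_le_one_le power_le_one)
    ultimately obtain w' where w': "\<bar>w'\<bar> \<le> \<rho> * \<bar>w\<bar>" "G w' \<le> G w"
      using step[of w] assms(4) by auto
    have "\<bar>w'\<bar> \<le> \<rho> ^ Suc k * \<bar>u\<bar>"
      using w'(1) mult_left_mono[OF w(1) assms(2)] by simp
    then show ?case
      using w w' by (meson order.trans)
  qed auto
  then obtain w where w: "\<And>k. \<bar>w k\<bar> \<le> \<rho> ^ k * \<bar>u\<bar>" "\<And>k. G (w k) \<le> G u"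
    by metis
  have "(\<lambda>k. \<rho> ^ k * \<bar>u\<bar>) \<longlonglongrightarrow> 0"
    using assms by (intro tendsto_mult_left_zero LIMSEQ_realpow_zero)
  then have "w \<longlonglongrightarrow> 0"
    by (rule tendsto_0_le[of _ _ _ 1]) (use w(1) assms(2) in \<open>simp add: abs_mult\<close>)
  then have "(\<lambda>k. G (w k)) \<longlonglongrightarrow> G 0"
    using isCont_tendsto_compose[OF assms(1)] by blast
  then show ?thesis
    by (rule tendsto_upperbound) (use w(2) in auto)
qed

text \<open>The two equations say that \<open>A B = A / t + B t\<close> for \<open>t = r\<close> and for
  \<open>t = s\<close>. Subtracting them gives \<open>A = B r s\<close>, and the solution
  \<open>A = B = 0\<close> is ruled out by \<open>A \<ge> r\<close>.\<close>

lemma two_slopes_determined: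
  fixes A B r s :: real
  assumes "r > 0" "s > 0" "r \<noteq> s" "A \<ge> r"
    and 1: "(A - r) * (B - 1 / r) = 1" and 2: "(A - s) * (B - 1 / s) = 1"
  shows "A = r + s" "B = 1 / r + 1 / s"
proof -
  have e1: "(A - r) * (B * r - 1) = r"
    using 1 assms(1) by (simp add: field_simps)
  have e2: "(A - s) * (B * s - 1) = s"
    using 2 assms(2) by (simp add: field_simps)
  have "(r - s) * (A - B * (r * s)) = s * ((A - r) * (B * r - 1)) - r * ((A - s) * (B * s - 1))"
    by (simp add: algebra_simps)
  also have "\<dots> = 0"
    by (simp add: e1 e2)
  finally have A: "A = B * (r * s)"
    using assms(3) by simp
  have "B * r * (B * (r * s) - (r + s)) = 0"
    using e1 unfolding A by (simp add: algebra_simps)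
  moreover have "B \<noteq> 0"
    using A assms(1,4) by auto
  ultimately have "B * (r * s) = r + s"
    using assms(1) by simp
  then show "A = r + s" "B = 1 / r + 1 / s"
    using assms(1,2) A by (simp_all add: field_simps)
qed

lemma compose_slopes:
  fixes K M :: real
  assumes "\<delta> > 0" "\<eta> > 0" "K > 0" "M > 0"
    and 1: "\<And>u::real. \<bar>u\<bar> < \<delta> \<Longrightarrow> \<exists>v. \<bar>v\<bar> \<le> K * \<bar>u\<bar> \<and> P u v"
    and 2: "\<And>v::real. \<bar>v\<bar> < \<eta> \<Longrightarrow> \<exists>w. \<bar>w\<bar> \<le> M * \<bar>v\<bar> \<and> Q v w"
  obtains \<epsilon> where "\<epsilon> > 0"
    "\<And>u. \<bar>u\<bar> < \<epsilon> \<Longrightarrow> \<exists>v w. \<bar>w\<bar> \<le> (M * K) * \<bar>u\<bar> \<and> P u v \<and> Q v w"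
proof
  show "min \<delta> (\<eta> / K) > 0"
    using assms by simp
  fix u assume u: "\<bar>u\<bar> < min \<delta> (\<eta> / K)"
  then obtain v where v: "\<bar>v\<bar> \<le> K * \<bar>u\<bar>" "P u v"
    using 1[of u] by auto
  have "K * \<bar>u\<bar> < \<eta>"
    using u \<open>K > 0\<close> by (simp add: field_simps)
  then obtain w where w: "\<bar>w\<bar> \<le> M * \<bar>v\<bar>" "Q v w"
    using 2[of v] v(1) by auto
  have "M * \<bar>v\<bar> \<le> (M * K) * \<bar>u\<bar>"
    using v(1) \<open>M > 0\<close> by simp
  with v w show "\<exists>v w. \<bar>w\<bar> \<le> (M * K) * \<bar>u\<bar> \<and> P u v \<and> Q v w"
    by (meson order.trans)
qed

context analytic_oval
begin

text \<open>The derivative of \<open>path_length\<close> in the first endpoint, multiplied by the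
  positive product of the two distances that occur as denominators. The factors
  \<open>T s \<bullet> (\<gamma> s - c)\<close> and
  \<open>T s \<bullet> (\<gamma> s - \<gamma> t)\<close> vanish on a double normal, so that only their
  first-order terms matter there.\<close>

definition reflection_defect :: "real \<Rightarrow> plane \<Rightarrow> real \<Rightarrow> real \<Rightarrow> real" where
  "reflection_defect \<sigma> c s t = \<sigma> * norm (\<gamma> s - \<gamma> t) * (T s \<bullet> (\<gamma> s - c)) +
     norm (\<gamma> s - c) * (T s \<bullet> (\<gamma> s - \<gamma> t))"

lemma reflection_defect_eq:
  assumes "c \<in> \<Omega>" "\<gamma> s \<noteq> \<gamma> t"
  shows "T s \<bullet> (\<sigma> *\<^sub>R sgn (\<gamma> s - c) + sgn (\<gamma> s - \<gamma> t)) =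
    reflection_defect \<sigma> c s t / (norm (\<gamma> s - c) * norm (\<gamma> s - \<gamma> t))"
  unfolding reflection_defect_def sgn_div_norm inner_add_right inner_scaleR_right
  using assms curve_neq[OF assms(1), of s] by (simp add: field_simps)

lemma max_pairing_defect:
  assumes "c \<in> \<Omega>" "max_pairing \<sigma> c E" "path_length \<sigma> c s t = E"
  shows "reflection_defect \<sigma> c s t = 0" "reflection_defect \<sigma> c t s = 0"
proof -
  have "reflection_defect \<sigma> c s t = 0" if "path_length \<sigma> c s t = E" for s t
  proof -
    have neq: "\<gamma> s \<noteq> \<gamma> t"
      using max_pairing_neq assms(2) that by blast
    have "reflection_defect \<sigma> c s t / (norm (\<gamma> s - c) * norm (\<gamma> s - \<gamma> t)) = 0"
      unfolding reflection_defect_eq[OF assms(1) neq, symmetric]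
      using assms(1,2) that neq by (intro path_length_critical) (auto simp: max_pairing_def)
    then show ?thesis
      using neq curve_neq[OF assms(1)] by simp
  qed
  then show "reflection_defect \<sigma> c s t = 0" "reflection_defect \<sigma> c t s = 0"
    using assms(3) path_length_commute by metis+
qed

text \<open>Here \<open>\<gamma> a\<close> and \<open>\<gamma> b\<close> span a chord through
  \<open>c\<close> that is normal to the boundary at \<open>\<gamma> a\<close>, and \<open>- m\<close>
  is the signed curvature there: the component of \<open>T'\<close> in the direction from
  \<open>\<gamma> a\<close> to \<open>\<gamma> b\<close>. The values of \<open>A\<close> and
  \<open>B\<close> at the origin are the partial derivatives of the defect.\<close>

lemma reflection_defect_expansion:
  fixes a b \<sigma> :: real and c :: plane
  defines "d \<equiv> dist (\<gamma> a) c" and "l \<equiv> dist (\<gamma> a) (\<gamma> b)"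
    and "m \<equiv> T' a \<bullet> (\<gamma> a - \<gamma> b) / dist (\<gamma> a) (\<gamma> b)"
  assumes c: "c \<in> closed_segment (\<gamma> a) (\<gamma> b)" and neq: "\<gamma> a \<noteq> \<gamma> b"
    and normal: "T a \<bullet> (\<gamma> a - \<gamma> b) = 0"
  obtains A B :: "real \<times> real \<Rightarrow> real"
  where "isCont A (0, 0)" "isCont B (0, 0)"
    and "A (0, 0) = \<sigma> * l * (1 + m * d) + d * (1 + m * l)" "B (0, 0) = - d * (T a \<bullet> T b)"
    and "\<And>u v. reflection_defect \<sigma> c (a + u) (b + v) = u * A (u, v) + v * B (u, v)"
proof -
  obtain k where "c = (1 - k) *\<^sub>R \<gamma> a + k *\<^sub>R \<gamma> b" "k \<ge> 0"
    using c by (auto simp: in_segment)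
  then have k: "\<gamma> a - c = k *\<^sub>R (\<gamma> a - \<gamma> b)" "k \<ge> 0"
    by (simp_all add: algebra_simps)
  have "l \<noteq> 0"
    using neq by (simp add: l_def)
  have "d = k * l"
    using k by (simp add: d_def l_def dist_norm)
  have ml: "T' a \<bullet> (\<gamma> a - \<gamma> b) = m * l"
    using \<open>l \<noteq> 0\<close> by (simp add: m_def l_def)
  have md: "T' a \<bullet> (\<gamma> a - c) = m * d"
    using ml by (simp add: k(1) \<open>d = k * l\<close>)
  have normal_c: "T a \<bullet> (\<gamma> a - c) = 0"
    using normal by (simp add: k(1))
  have TT: "T a \<bullet> T a = 1"
    by (simp add: dot_square_norm norm_T)
  have deriv: "((\<lambda>s. T s \<bullet> (\<gamma> s - p)) has_vector_derivative (T a \<bullet> T a + T' a \<bullet> (\<gamma> a - p))) (at a)" for p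
  proof -
    have "((\<lambda>s. \<gamma> s - p) has_vector_derivative T a) (at a)"
      using curve_derivative[of a] by (auto intro!: derivative_eq_intros)
    from bounded_bilinear.has_vector_derivative[OF bounded_bilinear_inner T_derivative this]
    show ?thesis .
  qed
  obtain g where g: "\<And>u. T (a + u) \<bullet> (\<gamma> (a + u) - c) = u * g u" "isCont g 0" "g 0 = 1 + m * d"
    using vector_caratheodory[OF deriv[of c]] by (auto simp: normal_c TT md)
  obtain h where h: "\<And>u. T (a + u) \<bullet> (\<gamma> (a + u) - \<gamma> b) = u * h u" "isCont h 0" "h 0 = 1 + m * l"
    using vector_caratheodory[OF deriv[of "\<gamma> b"]] by (auto simp: normal TT ml)
  obtain j where j: "\<And>v. \<gamma> (b + v) = \<gamma> b + v *\<^sub>R j v" "isCont j 0" "j 0 = T b"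
    using vector_caratheodory[OF curve_derivative[of b]] by auto
  define A where "A z = \<sigma> * norm (\<gamma> (a + fst z) - \<gamma> (b + snd z)) * g (fst z) +
    norm (\<gamma> (a + fst z) - c) * h (fst z)" for z :: "real \<times> real"
  define B where "B z = - norm (\<gamma> (a + fst z) - c) * (T (a + fst z) \<bullet> j (snd z))" for z :: "real \<times> real"
  have contT: "isCont T s" and cont\<gamma>: "isCont \<gamma> s" for s
    using T_derivative curve_derivative has_vector_derivative_continuous by blast+
  have cont: "isCont (\<lambda>z. \<gamma> (a + fst z)) (0::real \<times> real)" "isCont (\<lambda>z. \<gamma> (b + snd z)) (0::real \<times> real)"
      "isCont (\<lambda>z. T (a + fst z)) (0::real \<times> real)"
    by (rule isCont_o2[where g = \<gamma>] isCont_o2[where g = T];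
        simp add: cont\<gamma> contT continuous_intros)+
  have cont': "isCont (\<lambda>z. g (fst z)) (0::real \<times> real)" "isCont (\<lambda>z. h (fst z)) (0::real \<times> real)"
      "isCont (\<lambda>z. j (snd z)) (0::real \<times> real)"
    by (rule isCont_o2[where g = g] isCont_o2[where g = h] isCont_o2[where g = j];
        simp add: g(2) h(2) j(2) continuous_intros)+
  show thesis
  proof
    show "isCont A (0, 0)" "isCont B (0, 0)"
      unfolding A_def B_def zero_prod_def[symmetric] by (intro continuous_intros cont cont')+
    show "A (0, 0) = \<sigma> * l * (1 + m * d) + d * (1 + m * l)" "B (0, 0) = - d * (T a \<bullet> T b)"
      by (simp_all add: A_def B_def g h j l_def d_def dist_norm)
    fix u v
    have "T (a + u) \<bullet> (\<gamma> (a + u) - \<gamma> (b + v)) = u * h u - v * (T (a + u) \<bullet> j v)"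
      using h(1)[of u] j(1)[of v] by (simp add: inner_simps)
    then show "reflection_defect \<sigma> c (a + u) (b + v) = u * A (u, v) + v * B (u, v)"
      by (simp only: reflection_defect_def A_def B_def fst_conv snd_conv g(1)) (simp add: algebra_simps)
  qed
qed

text \<open>Partners depend continuously on the starting point where they are unique: the starting points
  with a partner outside the given neighbourhood form a compact set, and \<open>a\<close> is not in
  it.\<close>

lemma nearby_partner:
  assumes "max_pairing \<sigma> c E" and unique: "\<And>t. path_length \<sigma> c a t = E \<Longrightarrow> \<gamma> t = \<gamma> b"
    and "\<epsilon> > 0"
  obtains \<delta> where "\<delta> > 0"
    "\<And>u. \<bar>u\<bar> < \<delta> \<Longrightarrow> \<exists>v. \<bar>v\<bar> < \<epsilon> \<and> path_length \<sigma> c (a + u) (b + v) = E"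
proof -
  define K where "K = {b - L / 2 .. b + L / 2} - ball b \<epsilon>"
  define S where "S = fst ` ({z. (\<lambda>(s, t). path_length \<sigma> c s t) z = E} \<inter> cball a 1 \<times> K)"
  have "compact K"
    unfolding K_def by (intro compact_diff) auto
  moreover have "closed {z. (\<lambda>(s, t). path_length \<sigma> c s t) z = E}"
    by (intro closed_Collect_eq continuous_path_length continuous_on_const)
  ultimately have "compact S"
    unfolding S_def
    by (intro compact_continuous_image closed_Int_compact compact_Times continuous_intros) auto
  moreover have "a \<notin> S"
  proof
    assume "a \<in> S"
    then obtain t where t: "t \<in> K" "path_length \<sigma> c a t = E"
      by (auto simp: S_def)
    \<comment> \<open>The window of length \<open>L\<close> around \<open>b\<close> reaches each boundary point, and
        \<open>\<gamma> b\<close> only at its centre.\<close>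
    then have "\<bar>t - b\<bar> < L"
      using period_pos by (auto simp: K_def)
    then have "t = b"
      using unique t(2) curve_inj by blast
    then show False
      using t(1) \<open>\<epsilon> > 0\<close> by (simp add: K_def)
  qed
  ultimately obtain \<eta> where \<eta>: "\<eta> > 0" "ball a \<eta> \<inter> S = {}"
    using compact_imp_closed[of S] by (metis Compl_iff disjoint_eq_subset_Compl open_Compl open_contains_ball)
  show thesis
  proof
    show "min \<eta> 1 > 0"
      using \<eta> by simp
    fix u assume u: "\<bar>u\<bar> < min \<eta> 1"
    obtain t where "path_length \<sigma> c (a + u) t = E"
      using assms(1) unfolding max_pairing_def by blast
    moreover obtain t' where t': "\<gamma> t' = \<gamma> t" "\<bar>t' - b\<bar> \<le> L / 2"
      using curve_onto[OF curve_in_frontier] by blast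
    ultimately have E: "path_length \<sigma> c (a + u) t' = E"
      using path_length_cong by metis
    have "a + u \<in> ball a \<eta>"
      using u by (simp add: dist_norm)
    then have "a + u \<notin> S"
      using \<eta>(2) by blast
    then have "\<not> (t' \<in> K)"
      using E u by (force simp: S_def dist_norm)
    then have "\<bar>t' - b\<bar> < \<epsilon>"
      using t'(2) unfolding K_def abs_le_iff by (auto simp: dist_real_def)
    then show "\<exists>v. \<bar>v\<bar> < \<epsilon> \<and> path_length \<sigma> c (a + u) (b + v) = E"
      using E by (intro exI[of _ "t' - b"]) auto
  qed
qed

text \<open>Partners satisfy \<open>u A + v B = 0\<close>, so \<open>\<bar>v\<bar>\<close> is bounded by
  any constant above \<open>\<bar>A / B\<bar>\<close> at the origin times
  \<open>\<bar>u\<bar>\<close>.\<close>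

lemma partner_slope:
  assumes "c \<in> \<Omega>" "max_pairing \<sigma> c E" "\<And>t. path_length \<sigma> c a t = E \<Longrightarrow> \<gamma> t = \<gamma> b"
    and "c \<in> closed_segment (\<gamma> a) (\<gamma> b)" "\<gamma> a \<noteq> \<gamma> b"
    and "T a \<bullet> (\<gamma> a - \<gamma> b) = 0" and TT: "\<bar>T a \<bullet> T b\<bar> = 1"
  defines "d \<equiv> dist (\<gamma> a) c" and "l \<equiv> dist (\<gamma> a) (\<gamma> b)"
    and "m \<equiv> T' a \<bullet> (\<gamma> a - \<gamma> b) / dist (\<gamma> a) (\<gamma> b)"
  assumes K: "K > \<bar>\<sigma> * l * (1 + m * d) + d * (1 + m * l)\<bar> / d"
  obtains \<delta> where "\<delta> > 0"
    "\<And>u. \<bar>u\<bar> < \<delta> \<Longrightarrow> \<exists>v. \<bar>v\<bar> \<le> K * \<bar>u\<bar> \<and> path_length \<sigma> c (a + u) (b + v) = E"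
proof -
  obtain A B where AB: "isCont A (0, 0)" "isCont B (0, 0)"
    "A (0, 0) = \<sigma> * l * (1 + m * d) + d * (1 + m * l)" "B (0, 0) = - d * (T a \<bullet> T b)"
    and defect: "\<And>u v. reflection_defect \<sigma> c (a + u) (b + v) = u * A (u, v) + v * B (u, v)"
    using reflection_defect_expansion[OF assms(4-6), of \<sigma>] unfolding d_def l_def m_def by blast
  have "d > 0"
    using curve_neq[OF assms(1)] by (simp add: d_def)
  then have B0: "\<bar>B (0, 0)\<bar> = d"
    using TT by (simp add: AB(4) abs_mult)
  have cont: "isCont (\<lambda>z. K * \<bar>B z\<bar> - \<bar>A z\<bar>) (0, 0)"
    by (intro continuous_intros AB)
  have "K * \<bar>B (0, 0)\<bar> - \<bar>A (0, 0)\<bar> > 0"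
    using K \<open>d > 0\<close> unfolding B0 AB(3) by (simp add: field_simps)
  then have "\<forall>\<^sub>F z in nhds (0, 0). K * \<bar>B z\<bar> - \<bar>A z\<bar> > 0"
    using cont by (intro isCont_eventually_greater)
  then obtain \<eta> where "\<eta> > 0" and \<eta>: "\<And>z. dist z (0, 0) < \<eta> \<Longrightarrow> K * \<bar>B z\<bar> - \<bar>A z\<bar> > 0"
    unfolding eventually_nhds_metric by blast
  obtain \<delta> where "\<delta> > 0" and \<delta>: "\<And>u. \<bar>u\<bar> < \<delta> \<Longrightarrow> \<exists>v. \<bar>v\<bar> < \<eta> / 2 \<and> path_length \<sigma> c (a + u) (b + v) = E"
    using nearby_partner[OF assms(2,3), where \<epsilon> = "\<eta> / 2"] \<open>\<eta> > 0\<close> by auto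
  show thesis
  proof
    show "min \<delta> (\<eta> / 2) > 0"
      using \<open>\<delta> > 0\<close> \<open>\<eta> > 0\<close> by simp
    fix u assume u: "\<bar>u\<bar> < min \<delta> (\<eta> / 2)"
    then obtain v where v: "\<bar>v\<bar> < \<eta> / 2" "path_length \<sigma> c (a + u) (b + v) = E"
      using \<delta> by auto
    have "dist (u, v) (0, 0) < \<eta>"
      using u v(1) sqrt_sum_squares_le_sum_abs[of u v] by (simp add: dist_Pair_Pair dist_real_def)
    from \<eta>[OF this] have gap: "\<bar>A (u, v)\<bar> < K * \<bar>B (u, v)\<bar>"
      by simp
    have "u * A (u, v) = - (v * B (u, v))"
      using defect[of u v] max_pairing_defect(1)[OF assms(1,2) v(2)] by simp
    then have eq: "\<bar>v\<bar> * \<bar>B (u, v)\<bar> = \<bar>u\<bar> * \<bar>A (u, v)\<bar>"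
      by (metis abs_minus_cancel abs_mult)
    have "B (u, v) \<noteq> 0"
      using gap by auto
    moreover have "\<bar>v\<bar> * \<bar>B (u, v)\<bar> \<le> (K * \<bar>u\<bar>) * \<bar>B (u, v)\<bar>"
      unfolding eq using mult_left_mono[OF less_imp_le[OF gap], of "\<bar>u\<bar>"] by (simp add: mult_ac)
    ultimately have "\<bar>v\<bar> \<le> K * \<bar>u\<bar>"
      by simp
    with v show "\<exists>v. \<bar>v\<bar> \<le> K * \<bar>u\<bar> \<and> path_length \<sigma> c (a + u) (b + v) = E"
      by blast
  qed
qed

text \<open>The critical equations at both endpoints hold for the same pairs \<open>(u, v)\<close>. They
  are two homogeneous linear equations with a common solution \<open>u \<noteq> 0\<close>, so their
  determinant vanishes, and in the limit at the origin this is the stated relation.\<close>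

lemma partner_slopes_reciprocal:
  assumes "c \<in> \<Omega>" "max_pairing \<sigma> c E" "\<And>t. path_length \<sigma> c a t = E \<Longrightarrow> \<gamma> t = \<gamma> b"
    and "c \<in> closed_segment (\<gamma> a) (\<gamma> b)" "\<gamma> a \<noteq> \<gamma> b"
    and "T a \<bullet> (\<gamma> a - \<gamma> b) = 0" "T b \<bullet> (\<gamma> b - \<gamma> a) = 0" and TT: "\<bar>T a \<bullet> T b\<bar> = 1"
  defines "d \<equiv> dist (\<gamma> a) c" and "e \<equiv> dist (\<gamma> b) c" and "l \<equiv> dist (\<gamma> a) (\<gamma> b)"
    and "m \<equiv> T' a \<bullet> (\<gamma> a - \<gamma> b) / dist (\<gamma> a) (\<gamma> b)"
    and "n \<equiv> T' b \<bullet> (\<gamma> b - \<gamma> a) / dist (\<gamma> b) (\<gamma> a)"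
  shows "(\<sigma> * l * (1 + m * d) + d * (1 + m * l)) * (\<sigma> * l * (1 + n * e) + e * (1 + n * l)) = d * e"
proof -
  obtain A B where AB: "isCont A (0, 0)" "isCont B (0, 0)"
    "A (0, 0) = \<sigma> * l * (1 + m * d) + d * (1 + m * l)" "B (0, 0) = - d * (T a \<bullet> T b)"
    and defect: "\<And>u v. reflection_defect \<sigma> c (a + u) (b + v) = u * A (u, v) + v * B (u, v)"
    using reflection_defect_expansion[OF assms(4-6), of \<sigma>] unfolding d_def l_def m_def by blast
  have "c \<in> closed_segment (\<gamma> b) (\<gamma> a)" "\<gamma> b \<noteq> \<gamma> a" and l: "dist (\<gamma> b) (\<gamma> a) = l"
    using assms(4,5) by (simp_all add: closed_segment_commute l_def dist_commute)
  note expansion = reflection_defect_expansion[OF this(1,2) assms(7), of \<sigma>, folded e_def n_def, unfolded l]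
  obtain A' B' where AB': "isCont A' (0, 0)" "isCont B' (0, 0)"
    "A' (0, 0) = \<sigma> * l * (1 + n * e) + e * (1 + n * l)" "B' (0, 0) = - e * (T b \<bullet> T a)"
    and defect': "\<And>u v. reflection_defect \<sigma> c (b + v) (a + u) = v * A' (v, u) + u * B' (v, u)"
    by (rule expansion) blast
  define D where "D z = A z * A' (snd z, fst z) - B z * B' (snd z, fst z)" for z
  have "isCont (\<lambda>z. A' (snd z, fst z)) (0, 0)" "isCont (\<lambda>z. B' (snd z, fst z)) (0, 0)"
    by (rule isCont_o2[of "(0::real, 0::real)" _ A'] isCont_o2[of "(0::real, 0::real)" _ B'];
        use AB' in \<open>auto intro!: continuous_intros\<close>)+
  then have cont: "isCont D (0, 0)"
    unfolding D_def by (intro continuous_intros AB)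
  have "D (0, 0) = 0"
  proof (rule ccontr)
    assume "D (0, 0) \<noteq> 0"
    then obtain \<eta> where "\<eta> > 0" and \<eta>: "\<And>z. dist (0, 0) z < \<eta> \<Longrightarrow> D z \<noteq> 0"
      using continuous_at_avoid[OF cont] by metis
    obtain \<delta> where "\<delta> > 0" and \<delta>: "\<And>u. \<bar>u\<bar> < \<delta> \<Longrightarrow> \<exists>v. \<bar>v\<bar> < \<eta> / 2 \<and> path_length \<sigma> c (a + u) (b + v) = E"
      using nearby_partner[OF assms(2,3), where \<epsilon> = "\<eta> / 2"] \<open>\<eta> > 0\<close> by auto
    define u where "u = min \<delta> \<eta> / 2"
    have u: "u > 0" "\<bar>u\<bar> < \<delta>" "\<bar>u\<bar> \<le> \<eta> / 2"
      using \<open>\<delta> > 0\<close> \<open>\<eta> > 0\<close> by (auto simp: u_def)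
    then obtain v where v: "\<bar>v\<bar> < \<eta> / 2" "path_length \<sigma> c (a + u) (b + v) = E"
      using \<delta>[OF u(2)] by blast
    have "dist (0, 0) (u, v) < \<eta>"
      using u v(1) sqrt_sum_squares_le_sum_abs[of u v] by (simp add: dist_Pair_Pair dist_real_def)
    then have "D (u, v) \<noteq> 0"
      by (rule \<eta>)
    moreover have "u * A (u, v) + v * B (u, v) = 0" "v * A' (v, u) + u * B' (v, u) = 0"
      using max_pairing_defect[OF assms(1,2) v(2)] by (simp_all add: defect defect')
    then have "u * (A (u, v) * A' (v, u) - B (u, v) * B' (v, u)) = 0"
      by algebra
    then have "D (u, v) = 0"
      using u by (simp add: D_def)
    ultimately show False
      by simp
  qed
  moreover have "(T a \<bullet> T b) * (T b \<bullet> T a) = 1"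
    using TT by (metis abs_mult_self_eq inner_commute mult.right_neutral)
  ultimately show ?thesis
    by (simp add: D_def AB(3,4) AB'(3,4) algebra_simps)
qed

text \<open>The second derivative test. The left-hand side is, up to a positive factor, the second
  derivative of the length in the first endpoint at a maximum.\<close>

lemma path_length_second_order:
  assumes "c \<in> \<Omega>" "\<And>x. path_length \<sigma> c x b \<le> path_length \<sigma> c a b"
    and "c \<in> closed_segment (\<gamma> a) (\<gamma> b)" "\<gamma> a \<noteq> \<gamma> b" "T a \<bullet> (\<gamma> a - \<gamma> b) = 0"
  defines "d \<equiv> dist (\<gamma> a) c" and "l \<equiv> dist (\<gamma> a) (\<gamma> b)"
    and "m \<equiv> T' a \<bullet> (\<gamma> a - \<gamma> b) / dist (\<gamma> a) (\<gamma> b)"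
  shows "\<sigma> * l * (1 + m * d) + d * (1 + m * l) \<le> 0"
proof (rule ccontr)
  assume pos: "\<not> ?thesis"
  obtain A B where AB: "isCont A (0, 0)" "isCont B (0, 0)"
    "A (0, 0) = \<sigma> * l * (1 + m * d) + d * (1 + m * l)" "B (0, 0) = - d * (T a \<bullet> T b)"
    and defect: "\<And>u v. reflection_defect \<sigma> c (a + u) (b + v) = u * A (u, v) + v * B (u, v)"
    using reflection_defect_expansion[OF assms(3-5), of \<sigma>] unfolding d_def l_def m_def by blast
  have "isCont (\<lambda>u. A (u, 0)) 0"
    by (rule isCont_o2[of "0::real" _ A]) (use AB(1) in \<open>auto intro!: continuous_intros\<close>)
  moreover have "A (0, 0) > 0"
    using pos AB(3) by simp
  ultimately have "\<forall>\<^sub>F u in nhds 0. A (u, 0) > 0"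
    by (rule isCont_eventually_greater)
  moreover have "\<forall>\<^sub>F u in nhds 0. \<gamma> (a + u) \<noteq> \<gamma> b"
  proof -
    have "isCont (\<lambda>u. \<gamma> (a + u)) 0"
      using has_vector_derivative_continuous[OF curve_derivative[of a]]
      by (intro isCont_o2[of 0 "\<lambda>u. a + u" \<gamma>]) (auto intro!: continuous_intros)
    from continuous_at_avoid[OF this, of "\<gamma> b"] show ?thesis
      using assms(4) unfolding eventually_nhds_metric by (auto simp: dist_commute)
  qed
  ultimately have "\<forall>\<^sub>F u in nhds 0. A (u, 0) > 0 \<and> \<gamma> (a + u) \<noteq> \<gamma> b"
    by eventually_elim auto
  then obtain \<eta> where "\<eta> > 0" and \<eta>: "\<And>u. \<bar>u\<bar> < \<eta> \<Longrightarrow> A (u, 0) > 0 \<and> \<gamma> (a + u) \<noteq> \<gamma> b"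
    unfolding eventually_nhds_metric by (auto simp: dist_real_def)
  have der: "((\<lambda>x. path_length \<sigma> c x b) has_real_derivative
      u * A (u, 0) / (norm (\<gamma> (a + u) - c) * norm (\<gamma> (a + u) - \<gamma> b))) (at (a + u))"
    if "\<bar>u\<bar> < \<eta>" for u
    using path_length_derivative[OF assms(1), of "a + u" b \<sigma>] \<eta>[OF that] defect[of u 0]
    by (simp add: reflection_defect_eq[OF assms(1)])
  have "path_length \<sigma> c a b < path_length \<sigma> c (a + \<eta> / 2) b"
  proof (rule DERIV_pos_imp_increasing_open[where f = "\<lambda>x. path_length \<sigma> c x b"])
    fix x assume x: "a < x" "x < a + \<eta> / 2"
    let ?y = "(x - a) * A (x - a, 0) / (norm (\<gamma> x - c) * norm (\<gamma> x - \<gamma> b))"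
    have "?y > 0"
      using \<eta>[of "x - a"] x curve_neq[OF assms(1), of x] by auto
    then show "\<exists>y. ((\<lambda>x. path_length \<sigma> c x b) has_real_derivative y) (at x) \<and> 0 < y"
      using der[of "x - a"] x by auto
  next
    have "isCont (\<lambda>x. path_length \<sigma> c x b) x" if "a \<le> x" "x \<le> a + \<eta> / 2" for x
      using der[of "x - a"] that \<open>\<eta> > 0\<close> by (auto intro: DERIV_isCont)
    then show "continuous_on {a..a + \<eta> / 2} (\<lambda>x. path_length \<sigma> c x b)"
      by (simp add: continuous_at_imp_continuous_on)
  qed (use \<open>\<eta> > 0\<close> in auto)
  then show False
    using assms(2)[of "a + \<eta> / 2"] by simp
qed

end

section \<open>Ellipses and their foci\<close>

text \<open>The polynomial splits into four linear factors in the two distances and \<open>s\<close>, of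
  which only one can vanish when \<open>s\<close> exceeds the distance of the foci. A polynomial
  equation is what the identity theorem needs, since the distances themselves involve square
  roots.\<close>

lemma ellipse_equation_polynomial:
  fixes p f1 f2 :: "'a :: metric_space"
  assumes "s > dist f1 f2"
  shows "dist p f1 + dist p f2 = s \<longleftrightarrow>
    4 * s\<^sup>2 * (dist p f2)\<^sup>2 - (s\<^sup>2 + (dist p f2)\<^sup>2 - (dist p f1)\<^sup>2)\<^sup>2 = 0"
proof -
  let ?x = "dist p f1" and ?y = "dist p f2"
  have "4 * s\<^sup>2 * ?y\<^sup>2 - (s\<^sup>2 + ?y\<^sup>2 - ?x\<^sup>2)\<^sup>2 = (?x + ?y - s) * (?x + s - ?y) * (s + ?y - ?x) * (?x + ?y + s)"
    by (simp add: power2_eq_square algebra_simps)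
  moreover have "?x + s - ?y > 0" "s + ?y - ?x > 0" "?x + ?y + s > 0"
    using assms dist_triangle[of p f2 f1] dist_triangle[of p f1 f2] dist_commute[of f1 f2]
      zero_le_dist[of f1 f2] zero_le_dist[of p f1] zero_le_dist[of p f2] by linarith+
  ultimately show ?thesis
    by auto
qed

text \<open>The sum of the distances is convex along a ray from a focus, and at the focus it is less than
  \<open>s\<close>.\<close>

lemma ellipse_ray_less:
  fixes p f1 f2 :: "'a :: real_normed_vector"
  assumes "s > dist f1 f2" "dist p f1 + dist p f2 = s" "0 < k" "k < 1"
  defines "q \<equiv> f1 + k *\<^sub>R (p - f1)"
  shows "dist q f1 + dist q f2 < s"
proof -
  have "dist q f1 = k * dist p f1"
    using assms(3) by (simp add: q_def dist_norm)
  moreover have "q - f2 = (1 - k) *\<^sub>R (f1 - f2) + k *\<^sub>R (p - f2)"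
    by (simp add: q_def algebra_simps)
  then have "dist q f2 \<le> (1 - k) * dist f1 f2 + k * dist p f2"
    using norm_triangle_ineq[of "(1 - k) *\<^sub>R (f1 - f2)" "k *\<^sub>R (p - f2)"] assms(3,4)
    by (simp add: dist_norm)
  moreover have "(1 - k) * dist f1 f2 < (1 - k) * s"
    using assms by simp
  moreover have "k * dist p f1 + k * dist p f2 = k * s"
    using assms(2) by (metis distrib_left)
  ultimately show ?thesis
    by (simp add: algebra_simps)
qed

lemma bounded_translation_invariant:
  fixes E :: "'a :: real_normed_vector set"
  assumes "bounded E" "p \<in> E" and step: "\<And>p. p \<in> E \<Longrightarrow> p + v \<in> E"
  shows "v = 0"
proof (rule ccontr)
  assume "v \<noteq> 0"
  have orbit: "p + of_nat n *\<^sub>R v \<in> E" for n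
  proof (induction n)
    case (Suc n)
    then show ?case
      using step[of "p + of_nat n *\<^sub>R v"] by (simp add: algebra_simps)
  qed (use assms(2) in simp)
  obtain M where M: "\<And>x. x \<in> E \<Longrightarrow> norm x \<le> M"
    using assms(1) bounded_iff by blast
  obtain n :: nat where n: "real n > (M + norm p) / norm v"
    using reals_Archimedean2 by blast
  have "real n * norm v \<le> norm (p + of_nat n *\<^sub>R v) + norm p"
    using norm_triangle_ineq4[of "p + of_nat n *\<^sub>R v" p] by simp
  also have "\<dots> \<le> M + norm p"
    using M[OF orbit] by simp
  finally show False
    using n \<open>v \<noteq> 0\<close> by (simp add: field_simps)
qed

lemma ellipse_centre_symmetry:
  fixes f1 f2 :: "'a :: real_normed_vector"
  assumes "E = {p. dist p f1 + dist p f2 = s}" "p \<in> E"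
  shows "f1 + f2 - p \<in> E"
proof -
  have "dist (f1 + f2 - p) f1 = dist p f2" "dist (f1 + f2 - p) f2 = dist p f1"
    by (simp_all add: dist_norm norm_minus_commute)
  then show ?thesis
    using assms by auto
qed

text \<open>An ellipse is symmetric about its centre. Two centres give two point reflections, whose
  composition is a translation, and a bounded set is invariant only under the trivial one.\<close>

lemma common_focus_unique:
  assumes "ellipse_with_foci E f g" "ellipse_with_foci E f h" "bounded E" "E \<noteq> {}"
  shows "g = h"
proof -
  obtain s t where E: "E = {p. dist p f + dist p g = s}" "E = {p. dist p f + dist p h = t}"
    using assms(1,2) unfolding ellipse_with_foci_def by blast
  obtain p where "p \<in> E"
    using assms(4) by blast
  have "p + (h - g) \<in> E" if "p \<in> E" for p
    using ellipse_centre_symmetry[OF E(2) ellipse_centre_symmetry[OF E(1) that]]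
    by (simp add: algebra_simps)
  then have "h - g = 0"
    using bounded_translation_invariant[OF assms(3) \<open>p \<in> E\<close>] by blast
  then show ?thesis
    by simp
qed

text \<open>As for a common focus, the centre of the circle must be the midpoint of the foci. The foci
  lie inside, because the distance sum exceeds their distance. The circle, of radius \<open>r\<close>
  say, then meets the line through the foci in points with distance sum \<open>2 * r\<close>, but the
  perpendicular through its centre in points with a larger sum.\<close>

lemma ellipse_not_circular:
  assumes "ellipse_with_foci E f1 f2" "bounded E" "E \<noteq> {}" "f1 \<noteq> f2"
  shows "\<not> circular E"
proof
  assume "circular E"
  then obtain z r where sphere: "E = sphere z r"
    unfolding circular_def by blast
  obtain s where s: "s > dist f1 f2" and E: "E = {p. dist p f1 + dist p f2 = s}"
    using assms(1) unfolding ellipse_with_foci_def by blast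
  obtain p where "p \<in> E"
    using assms(3) by blast
  have "r \<ge> 0"
    using \<open>p \<in> E\<close> sphere zero_le_dist[of z p] by simp
  have "p + (f1 + f2 - 2 *\<^sub>R z) \<in> E" if "p \<in> E" for p
  proof -
    have "2 *\<^sub>R z - p \<in> E"
      using that by (simp add: sphere dist_norm scaleR_2 norm_minus_commute)
    from ellipse_centre_symmetry[OF E this] show ?thesis
      by (simp add: algebra_simps)
  qed
  then have centre: "f1 + f2 = 2 *\<^sub>R z"
    using bounded_translation_invariant[OF assms(2) \<open>p \<in> E\<close>] by fastforce
  define h where "h = z - f1"
  have f: "f1 = z - h" "f2 = z + h"
    using centre by (simp_all add: h_def scaleR_2 algebra_simps)
  have "h \<noteq> 0"
    using assms(4) f by auto
  obtain q :: plane where q: "q \<noteq> 0" "orthogonal h q"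
    using orthogonal_to_vector_exists[of h] by auto
  have "z + r *\<^sub>R sgn h \<in> E"
    using \<open>r \<ge> 0\<close> \<open>h \<noteq> 0\<close> by (simp add: sphere dist_norm norm_sgn)
  moreover have "dist (z + r *\<^sub>R sgn h) f1 = r + norm h"
  proof -
    have "z + r *\<^sub>R sgn h - f1 = (r + norm h) *\<^sub>R sgn h"
      by (simp add: f algebra_simps norm_sgn_scaleR)
    then show ?thesis
      using \<open>r \<ge> 0\<close> \<open>h \<noteq> 0\<close> by (simp add: dist_norm norm_sgn)
  qed
  moreover have "dist (z + r *\<^sub>R sgn h) f2 = \<bar>r - norm h\<bar>"
  proof -
    have "z + r *\<^sub>R sgn h - f2 = (r - norm h) *\<^sub>R sgn h"
      by (simp add: f algebra_simps norm_sgn_scaleR)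
    then show ?thesis
      using \<open>h \<noteq> 0\<close> by (simp add: dist_norm norm_sgn)
  qed
  moreover have "dist f1 f2 = 2 * norm h"
  proof -
    have "f1 - f2 = (- 2) *\<^sub>R h"
      by (simp add: f scaleR_2)
    then show ?thesis
      by (simp only: dist_norm norm_scaleR)
  qed
  ultimately have axis: "s = 2 * r"
    using s by (auto simp: E)
  have perp: "dist (z + r *\<^sub>R sgn q) f > r" if "f = f1 \<or> f = f2" for f
  proof -
    have "f = z + (- 1) *\<^sub>R h \<or> f = z + 1 *\<^sub>R h"
      using that f by auto
    then obtain \<tau> :: real where \<tau>: "f = z + \<tau> *\<^sub>R h" "\<tau> * \<tau> = 1"
      by (elim disjE) fastforce+
    have "(dist (z + r *\<^sub>R sgn q) f)\<^sup>2 = (r *\<^sub>R sgn q - \<tau> *\<^sub>R h) \<bullet> (r *\<^sub>R sgn q - \<tau> *\<^sub>R h)"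
      by (simp add: dist_norm \<tau>(1) power2_norm_eq_inner)
    also have "\<dots> = r\<^sup>2 * (sgn q \<bullet> sgn q) + (\<tau> * \<tau>) * (h \<bullet> h)"
      using q(2) by (simp add: inner_diff_left inner_diff_right orthogonal_def sgn_div_norm
          inner_commute power2_eq_square)
    also have "\<dots> = r\<^sup>2 + h \<bullet> h"
      using q(1) \<tau>(2) by (simp add: dot_square_norm norm_sgn)
    also have "\<dots> > r\<^sup>2"
      using \<open>h \<noteq> 0\<close> by simp
    finally show ?thesis
      by (rule power_less_imp_less_base) simp
  qed
  have "z + r *\<^sub>R sgn q \<in> E"
    using \<open>r \<ge> 0\<close> q by (simp add: sphere dist_norm norm_sgn)
  then show False
    using perp[of f1] perp[of f2] axis by (simp add: E)
qed

context analytic_oval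
begin

section \<open>Two focal points\<close>

text \<open>The ray from \<open>c1\<close> through \<open>c2\<close> meets the boundary in
  \<open>\<gamma> a\<close>. Both points see \<open>\<gamma> a\<close> in the same direction, so the
  reflected rays agree and lead to the same \<open>\<gamma> b\<close>. Reversing the path, the ray from
  \<open>\<gamma> a\<close> is reflected at \<open>\<gamma> b\<close> towards both \<open>c1\<close> and
  \<open>c2\<close>; hence \<open>\<gamma> b\<close> lies on the same line. There incoming and reflected
  directions are opposite, which makes the line normal to the boundary at both endpoints.\<close>

lemma focal_axis:
  assumes c: "c1 \<in> \<Omega>" "c2 \<in> \<Omega>" "c1 \<noteq> c2"
    and pair: "max_pairing 1 c1 E1" "max_pairing 1 c2 E2"
  obtains a b where "path_length 1 c1 a b = E1" "path_length 1 c2 a b = E2"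
    and "c1 \<in> closed_segment (\<gamma> a) (\<gamma> b)" "c2 \<in> closed_segment (\<gamma> a) (\<gamma> b)"
    and "T a \<bullet> (\<gamma> a - \<gamma> b) = 0" "T b \<bullet> (\<gamma> b - \<gamma> a) = 0"
    and "dist (\<gamma> a) c2 < dist (\<gamma> a) c1"
proof -
  define w where "w = c2 - c1"
  have "w \<noteq> 0"
    using c by (simp add: w_def)
  obtain k where "k > 0" and k: "c2 + k *\<^sub>R w \<in> frontier \<Omega>"
    using ray_to_frontier[OF bounded, of c2 w] c(2) open_domain \<open>w \<noteq> 0\<close> by (metis interior_open)
  obtain a where a: "\<gamma> a = c2 + k *\<^sub>R w"
    using curve_onto[OF k] by blast
  have xc: "\<gamma> a - c1 = (1 + k) *\<^sub>R w" "\<gamma> a - c2 = k *\<^sub>R w"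
    by (simp_all add: a w_def algebra_simps)
  obtain b b2 where b: "path_length 1 c1 a b = E1" "path_length 1 c2 a b2 = E2"
    using pair unfolding max_pairing_def by blast
  have neq: "\<gamma> a \<noteq> \<gamma> b" "\<gamma> a \<noteq> \<gamma> b2"
    using b max_pairing_neq pair by blast+
  have max: "path_length 1 c1 x y \<le> E1" "path_length 1 c2 x y \<le> E2" for x y
    using pair by (auto simp: max_pairing_def)
  have dir: "sgn (\<gamma> a - c1) = sgn w" "sgn (\<gamma> a - c2) = sgn w"
    unfolding xc using \<open>k > 0\<close> by (simp_all add: sgn_scaleR)
  have "sgn (\<gamma> b - \<gamma> a) = sgn (\<gamma> b2 - \<gamma> a)"
    using longest_path_reflects[OF c(1) _ neq(1)] longest_path_reflects[OF c(2) _ neq(2)] b max dir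
    by simp
  then have "\<gamma> b = \<gamma> a + norm (\<gamma> b - \<gamma> a) *\<^sub>R sgn (\<gamma> b - \<gamma> a)"
      "\<gamma> b2 = \<gamma> a + norm (\<gamma> b2 - \<gamma> a) *\<^sub>R sgn (\<gamma> b - \<gamma> a)"
    using norm_sgn_scaleR[of "\<gamma> b - \<gamma> a"] norm_sgn_scaleR[of "\<gamma> b2 - \<gamma> a"] by simp_all
  then have "norm (\<gamma> b - \<gamma> a) = norm (\<gamma> b2 - \<gamma> a)"
    using frontier_ray_unique[OF curve_closure[of a], of "norm (\<gamma> b - \<gamma> a)" "sgn (\<gamma> b - \<gamma> a)" "norm (\<gamma> b2 - \<gamma> a)"]
      curve_in_frontier[of b] curve_in_frontier[of b2] neq by (simp add: sgn_zero_iff)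
  with \<open>sgn (\<gamma> b - \<gamma> a) = sgn (\<gamma> b2 - \<gamma> a)\<close> have "\<gamma> b2 = \<gamma> b"
    by (metis add_diff_cancel_left' diff_add_cancel norm_sgn_scaleR)
  then have b2: "path_length 1 c2 a b = E2"
    using b(2) path_length_cong by metis
  define u1 u2 z where "u1 = sgn (\<gamma> b - c1)" and "u2 = sgn (\<gamma> b - c2)" and "z = sgn (\<gamma> a - \<gamma> b)"
  have z: "z = (2 * (u1 \<bullet> T b)) *\<^sub>R T b - u1" "z = (2 * (u2 \<bullet> T b)) *\<^sub>R T b - u2"
    unfolding z_def u1_def u2_def
    using b(1) b2 neq(1) max path_length_commute by (intro longest_path_reflects c; metis)+
  have "T b \<bullet> T b = 1"
    by (simp add: dot_square_norm norm_T)
  then have zT: "z \<bullet> T b = u1 \<bullet> T b" "z \<bullet> T b = u2 \<bullet> T b"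
    using arg_cong[OF z(1), of "\<lambda>v. v \<bullet> T b"] arg_cong[OF z(2), of "\<lambda>v. v \<bullet> T b"]
    by (simp_all add: inner_simps)
  \<comment> \<open>Reflection in the tangent at \<open>\<gamma> b\<close> is an involution, so \<open>z\<close>
      determines both directions.\<close>
  have "u1 = (2 * (u1 \<bullet> T b)) *\<^sub>R T b - z"
    by (simp add: z(1))
  also have "\<dots> = (2 * (u2 \<bullet> T b)) *\<^sub>R T b - z"
    by (simp only: zT[symmetric])
  also have "\<dots> = u2"
    by (simp add: z(2))
  finally have "u1 = u2" .
  have y: "\<gamma> b = c1 + norm (\<gamma> b - c1) *\<^sub>R u1" "\<gamma> b = c2 + norm (\<gamma> b - c2) *\<^sub>R u1"
    by (simp add: u1_def norm_sgn_scaleR) (simp add: \<open>u1 = u2\<close> u2_def norm_sgn_scaleR)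
  define \<kappa> where "\<kappa> = norm (\<gamma> b - c1) - norm (\<gamma> b - c2)"
  have w: "w = \<kappa> *\<^sub>R u1"
    using y unfolding w_def \<kappa>_def by (simp add: algebra_simps)
  have "\<kappa> \<noteq> 0"
    using w \<open>w \<noteq> 0\<close> by auto
  \<comment> \<open>Otherwise \<open>\<gamma> b\<close> and \<open>\<gamma> a\<close> would lie on the same ray from
      \<open>c1\<close> and coincide.\<close>
  have "\<kappa> < 0"
  proof (rule ccontr)
    assume "\<not> \<kappa> < 0"
    with \<open>\<kappa> \<noteq> 0\<close> have "\<kappa> > 0"
      by simp
    have "\<gamma> a = c1 + ((1 + k) * \<kappa>) *\<^sub>R u1"
      using xc(1) w by (simp add: algebra_simps)
    moreover have "norm (\<gamma> b - c1) > 0"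
      using curve_neq[OF c(1)] by simp
    moreover have "u1 \<noteq> 0"
      using curve_neq[OF c(1)] by (simp add: u1_def sgn_zero_iff)
    ultimately have "(1 + k) * \<kappa> = norm (\<gamma> b - c1)"
      using frontier_ray_unique[OF domain_in_closure[OF c(1)]] y(1) curve_in_frontier \<open>k > 0\<close> \<open>\<kappa> > 0\<close>
      by (metis add_pos_pos mult_pos_pos zero_less_one)
    then show False
      using neq(1) y(1) \<open>\<gamma> a = c1 + ((1 + k) * \<kappa>) *\<^sub>R u1\<close> by metis
  qed
  define h where "h = norm (\<gamma> b - c1) / (- \<kappa>)"
  have "h > 0"
    unfolding h_def using \<open>\<kappa> < 0\<close> curve_neq[OF c(1)] by (intro divide_pos_pos) simp_all
  have yw: "\<gamma> b = c1 - h *\<^sub>R w"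
    using y(1) \<open>\<kappa> \<noteq> 0\<close> by (simp add: h_def w)
  have xy: "\<gamma> a - \<gamma> b = (1 + k + h) *\<^sub>R w"
    using xc(1) by (simp add: yw algebra_simps)
  then have "\<gamma> b - \<gamma> a = - ((1 + k + h) *\<^sub>R w)"
    by (metis minus_diff_eq)
  have seg: "c \<in> closed_segment (\<gamma> a) (\<gamma> b)" if "\<gamma> a - c = j *\<^sub>R w" "0 \<le> j" "j \<le> 1 + k + h" for c j
  proof -
    have "(j / (1 + k + h)) *\<^sub>R (\<gamma> a - \<gamma> b) = \<gamma> a - c"
      using \<open>k > 0\<close> \<open>h > 0\<close> unfolding xy that(1) by simp
    then have "c = (1 - j / (1 + k + h)) *\<^sub>R \<gamma> a + (j / (1 + k + h)) *\<^sub>R \<gamma> b"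
      by (simp add: algebra_simps)
    moreover have "0 \<le> j / (1 + k + h)" "j / (1 + k + h) \<le> 1"
      using that(2,3) \<open>k > 0\<close> \<open>h > 0\<close> by simp_all
    ultimately show ?thesis
      unfolding in_segment by blast
  qed
  have "T a \<bullet> (1 *\<^sub>R sgn (\<gamma> a - c1) + sgn (\<gamma> a - \<gamma> b)) = 0"
    using b(1) max neq(1) by (intro path_length_critical c) auto
  moreover have "sgn (\<gamma> a - \<gamma> b) = sgn w"
    unfolding xy using \<open>k > 0\<close> \<open>h > 0\<close> by (simp add: sgn_scaleR)
  ultimately have "T a \<bullet> sgn w = 0"
    unfolding dir by (simp only: scaleR_one inner_add_right)
  then have Ta: "T a \<bullet> w = 0"
    by (metis inner_scaleR_right mult_zero_right norm_sgn_scaleR)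
  have "T b \<bullet> (1 *\<^sub>R sgn (\<gamma> b - c1) + sgn (\<gamma> b - \<gamma> a)) = 0"
    using b(1) max neq(1) path_length_commute by (intro path_length_critical c) (metis, metis)
  moreover have "sgn (\<gamma> b - \<gamma> a) = - sgn w"
    unfolding \<open>\<gamma> b - \<gamma> a = - ((1 + k + h) *\<^sub>R w)\<close>
    using \<open>k > 0\<close> \<open>h > 0\<close> by (simp add: sgn_scaleR sgn_minus)
  moreover have "sgn (\<gamma> b - c1) = - sgn w"
    unfolding yw using \<open>h > 0\<close> by (simp add: sgn_scaleR sgn_minus)
  ultimately have "T b \<bullet> sgn w = 0"
    by (simp only: scaleR_one inner_add_right inner_minus_right)
  then have Tb: "T b \<bullet> w = 0"
    by (metis inner_scaleR_right mult_zero_right norm_sgn_scaleR)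
  show thesis
  proof
    show "c1 \<in> closed_segment (\<gamma> a) (\<gamma> b)" "c2 \<in> closed_segment (\<gamma> a) (\<gamma> b)"
      using seg[OF xc(1)] seg[OF xc(2)] \<open>k > 0\<close> \<open>h > 0\<close> by auto
    show "T a \<bullet> (\<gamma> a - \<gamma> b) = 0" "T b \<bullet> (\<gamma> b - \<gamma> a) = 0"
      unfolding xy \<open>\<gamma> b - \<gamma> a = - ((1 + k + h) *\<^sub>R w)\<close> using Ta Tb by simp_all
    show "dist (\<gamma> a) c2 < dist (\<gamma> a) c1"
      using \<open>k > 0\<close> \<open>w \<noteq> 0\<close> unfolding dist_norm xc by simp
  qed fact+
qed

text \<open>Passing to a partner for one focal point and then along a chord through the same point does
  not increase \<open>g\<close>; the opposite order does not decrease it. Using \<open>c2\<close> for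
  the first and \<open>c1\<close> for the second, both compositions contract towards
  \<open>\<gamma> a\<close>, the endpoint of the axis nearer to \<open>c2\<close>, with slope
  \<open>r1 / r2\<close>.\<close>

lemma focal_sum_locally_constant:
  assumes "focal_point \<Omega> \<gamma> c1" "focal_point \<Omega> \<gamma> c2" "c1 \<noteq> c2"
  defines "g \<equiv> \<lambda>s. dist (\<gamma> s) c1 + dist (\<gamma> s) c2"
  obtains a where "\<forall>\<^sub>F s in nhds a. g s = g a"
proof -
  have c: "c1 \<in> \<Omega>" "c2 \<in> \<Omega>"
    using assms by (simp_all add: focal_point_def)
  obtain E1 E2 where pair: "max_pairing 1 c1 E1" "max_pairing 1 c2 E2"
    using assms focal_point_max_pairing by metis
  obtain a b where ab: "path_length 1 c1 a b = E1" "path_length 1 c2 a b = E2"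
    and seg: "c1 \<in> closed_segment (\<gamma> a) (\<gamma> b)" "c2 \<in> closed_segment (\<gamma> a) (\<gamma> b)"
    and normal: "T a \<bullet> (\<gamma> a - \<gamma> b) = 0" "T b \<bullet> (\<gamma> b - \<gamma> a) = 0"
    and less: "dist (\<gamma> a) c2 < dist (\<gamma> a) c1"
    using focal_axis[OF c assms(3) pair] by blast
  define l m n where "l = dist (\<gamma> a) (\<gamma> b)"
    and "m = T' a \<bullet> (\<gamma> a - \<gamma> b) / dist (\<gamma> a) (\<gamma> b)"
    and "n = T' b \<bullet> (\<gamma> b - \<gamma> a) / dist (\<gamma> b) (\<gamma> a)"
  define d1 d2 e1 e2 where "d1 = dist (\<gamma> a) c1" and "d2 = dist (\<gamma> a) c2"
    and "e1 = dist (\<gamma> b) c1" and "e2 = dist (\<gamma> b) c2"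
  note defs = l_def m_def n_def d1_def d2_def e1_def e2_def
  have pos: "d1 > 0" "d2 > 0" "e1 > 0" "e2 > 0"
    using curve_neq c by (auto simp: defs)
  have split: "d1 + e1 = l" "d2 + e2 = l"
    using seg by (simp_all add: defs between dist_commute flip: between_mem_segment)
  have E: "E1 = 2 * l" "E2 = 2 * l"
    using ab split by (simp_all add: path_length_def defs)
  have neq: "\<gamma> a \<noteq> \<gamma> b" "\<gamma> b \<noteq> \<gamma> a"
    using max_pairing_neq[OF pair(1) ab(1)] by simp_all
  have seg': "c1 \<in> closed_segment (\<gamma> b) (\<gamma> a)" "c2 \<in> closed_segment (\<gamma> b) (\<gamma> a)"
    using seg by (simp_all add: closed_segment_commute)
  have TT: "\<bar>T a \<bullet> T b\<bar> = 1" "\<bar>T b \<bullet> T a\<bar> = 1"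
  proof -
    have "T b \<bullet> (\<gamma> a - \<gamma> b) = 0"
      using normal(2) by (simp add: inner_diff_right)
    then show "\<bar>T a \<bullet> T b\<bar> = 1" "\<bar>T b \<bullet> T a\<bar> = 1"
      using plane_unit_normals_parallel[OF norm_T norm_T normal(1), of b] neq
      by (simp_all add: inner_commute[of "T b"])
  qed
  have unique: "\<gamma> t = \<gamma> b" if "path_length 1 c1 a t = E1 \<or> path_length 1 c2 a t = E2 \<or>
      path_length (- 1) c1 a t = 0 \<or> path_length (- 1) c2 a t = 0" for t
    using that longest_path_unique[OF c(1) pair(1) _ ab(1)] longest_path_unique[OF c(2) pair(2) _ ab(2)]
      chord_unique[OF c(1)] chord_unique[OF c(2)] seg unfolding detour_eq_0_iff[symmetric] by metis
  have unique': "\<gamma> t = \<gamma> a" if "path_length 1 c1 b t = E1 \<or> path_length 1 c2 b t = E2 \<or>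
      path_length (- 1) c1 b t = 0 \<or> path_length (- 1) c2 b t = 0" for t
    using that longest_path_unique[OF c(1) pair(1), of b t a] longest_path_unique[OF c(2) pair(2), of b t a]
      chord_unique[OF c(1), of b t a] chord_unique[OF c(2), of b t a] seg' ab path_length_commute
    unfolding detour_eq_0_iff[symmetric] by metis
  define r1 r2 where "r1 = e1 / d1" and "r2 = e2 / d2"
  have r: "r1 > 0" "r2 > 0"
    using pos by (simp_all add: r1_def r2_def)
  have "r1 < r2"
  proof -
    have "e1 * d2 < e2 * d1"
      using less split pos unfolding defs[symmetric] by (smt (verit) mult_strict_mono)
    then show ?thesis
      using pos by (simp add: r1_def r2_def field_simps)
  qed
  \<comment> \<open>In terms of \<open>A\<close> and \<open>B\<close>, which do not depend on the focal point, the slopes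
      of its two partner maps are \<open>A - r\<close> and \<open>B - 1 / r\<close> up to sign.\<close>
  define A B where "A = - 2 - 2 * m * l" and "B = - 2 - 2 * n * l"
  have coeff: "1 * l * (1 + m * d) + d * (1 + m * l) = - d * (A - e / d)"
    "1 * l * (1 + n * e) + e * (1 + n * l) = - e * (B - 1 / (e / d))"
    if "d > 0" "e > 0" "d + e = l" for d e
    using that by (simp_all add: A_def B_def field_simps flip: that(3))
  have prod: "(A - e / d) * (B - 1 / (e / d)) = 1"
    if "d > 0" "e > 0" "d + e = l"
      "(1 * l * (1 + m * d) + d * (1 + m * l)) * (1 * l * (1 + n * e) + e * (1 + n * l)) = d * e" for d e
  proof -
    have "(d * e) * ((A - e / d) * (B - 1 / (e / d))) = (d * e) * 1"
      using that(4) unfolding coeff[OF that(1-3)] by simp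
    then show ?thesis
      using that(1,2) by (metis mult_cancel_left mult_pos_pos less_irrefl)
  qed
  have "(A - r1) * (B - 1 / r1) = 1"
    unfolding r1_def
    using partner_slopes_reciprocal[OF c(1) pair(1) unique seg(1) neq(1) normal TT(1)]
    by (intro prod pos split) (simp_all add: defs dist_commute)
  moreover have "(A - r2) * (B - 1 / r2) = 1"
    unfolding r2_def
    using partner_slopes_reciprocal[OF c(2) pair(2) unique seg(2) neq(1) normal TT(1)]
    by (intro prod pos split) (simp_all add: defs dist_commute)
  moreover have "A \<ge> r1"
  proof -
    have "1 * l * (1 + m * d1) + d1 * (1 + m * l) \<le> 0"
      unfolding defs
      using pair(1) ab(1) by (intro path_length_second_order c seg neq normal) (simp add: max_pairing_def)
    then have "d1 * (A - r1) \<ge> 0"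
      unfolding coeff(1)[OF pos(1,3) split(1)] r1_def by simp
    then show ?thesis
      using pos(1) by (simp add: zero_le_mult_iff)
  qed
  ultimately have AB: "A = r1 + r2" "B = 1 / r1 + 1 / r2"
    using two_slopes_determined[of r1 r2 A B] r \<open>r1 < r2\<close> by auto
  have "1 / r2 < 1 / r1"
    using r \<open>r1 < r2\<close> by (simp add: field_simps)
  \<comment> \<open>\<open>K\<close> and \<open>M\<close> bound the slopes from \<open>\<gamma> a\<close> to
      \<open>\<gamma> b\<close> and back, strictly enough to leave \<open>M * K < 1\<close>.\<close>
  then obtain M where M: "1 / r2 < M" "M < 1 / r1"
    using dense by blast
  then have "M > 0"
    using r by (metis less_trans zero_less_divide_1_iff)
  then have "r1 < 1 / M"
    using M(2) r(1) by (simp add: field_simps)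
  then obtain K where K: "r1 < K" "K < 1 / M"
    using dense by blast
  have "K > 0" "M * K < 1" "0 \<le> M * K"
    using K r \<open>M > 0\<close> by (simp_all add: field_simps)
  have bound: "\<bar>1 * l * (1 + m * d2) + d2 * (1 + m * l)\<bar> / d2 < K"
      "\<bar>1 * l * (1 + n * e1) + e1 * (1 + n * l)\<bar> / e1 < M"
    unfolding coeff(1)[OF pos(2,4) split(2)] coeff(2)[OF pos(1,3) split(1)]
      r1_def[symmetric] r2_def[symmetric] AB
    using K(1) M(1) r pos by (simp_all add: abs_mult)
  have "- 1 * l * (1 + m * d1) + d1 * (1 + m * l) = - e1"
      "- 1 * l * (1 + n * e2) + e2 * (1 + n * l) = - d2"
    using split by (simp_all add: algebra_simps)
  then have bound': "\<bar>- 1 * l * (1 + m * d1) + d1 * (1 + m * l)\<bar> / d1 < K"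
      "\<bar>- 1 * l * (1 + n * e2) + e2 * (1 + n * l)\<bar> / e2 < M"
    using K(1) M(1) pos by (simp_all only: abs_minus_cancel) (simp_all add: r1_def r2_def)
  have lb: "dist (\<gamma> b) (\<gamma> a) = l"
    by (simp add: l_def dist_commute)
  obtain \<delta>1 where \<delta>1: "\<delta>1 > 0"
    "\<And>u. \<bar>u\<bar> < \<delta>1 \<Longrightarrow> \<exists>v. \<bar>v\<bar> \<le> K * \<bar>u\<bar> \<and> path_length 1 c2 (a + u) (b + v) = E2"
    using partner_slope[OF c(2) pair(2) unique seg(2) neq(1) normal(1) TT(1) bound(1)[unfolded defs]]
    by blast
  obtain \<delta>2 where \<delta>2: "\<delta>2 > 0"
    "\<And>v. \<bar>v\<bar> < \<delta>2 \<Longrightarrow> \<exists>w. \<bar>w\<bar> \<le> M * \<bar>v\<bar> \<and> path_length (- 1) c2 (b + v) (a + w) = 0"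
    using partner_slope[OF c(2) chord_max_pairing[OF c(2)] unique' seg'(2) neq(2) normal(2) TT(2)
      bound'(2)[unfolded n_def e2_def lb[symmetric]]] by blast
  obtain \<delta>3 where \<delta>3: "\<delta>3 > 0"
    "\<And>u. \<bar>u\<bar> < \<delta>3 \<Longrightarrow> \<exists>v. \<bar>v\<bar> \<le> K * \<bar>u\<bar> \<and> path_length (- 1) c1 (a + u) (b + v) = 0"
    using partner_slope[OF c(1) chord_max_pairing[OF c(1)] unique seg(1) neq(1) normal(1) TT(1)
      bound'(1)[unfolded defs]] by blast
  obtain \<delta>4 where \<delta>4: "\<delta>4 > 0"
    "\<And>v. \<bar>v\<bar> < \<delta>4 \<Longrightarrow> \<exists>w. \<bar>w\<bar> \<le> M * \<bar>v\<bar> \<and> path_length 1 c1 (b + v) (a + w) = E1"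
    using partner_slope[OF c(1) pair(1) unique' seg'(1) neq(2) normal(2) TT(2)
      bound(2)[unfolded n_def e1_def lb[symmetric]]] by blast
  \<comment> \<open>Triangle inequality at the focal point that the path does not use.\<close>
  have ge: "g s + g t \<ge> 2 * l" if "path_length 1 c1 s t = E1 \<or> path_length 1 c2 s t = E2" for s t
    using that dist_triangle2[of "\<gamma> s" "\<gamma> t" c1] dist_triangle2[of "\<gamma> s" "\<gamma> t" c2]
    by (auto simp: path_length_def g_def E)
  \<comment> \<open>The chord through one focal point, closed up over the other, is a path of length
      \<open>g s + g t\<close>.\<close>
  have le: "g s + g t \<le> 2 * l" if "path_length (- 1) c1 s t = 0 \<or> path_length (- 1) c2 s t = 0" for s t
  proof -
    have "path_length 1 c1 s t \<le> 2 * l" "path_length 1 c2 s t \<le> 2 * l"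
      using pair unfolding max_pairing_def E by blast+
    then show ?thesis
      using that by (auto simp: path_length_def g_def)
  qed
  have cont: "isCont (\<lambda>u. g (a + u)) 0"
    unfolding g_def
    using has_vector_derivative_continuous[OF curve_derivative[of a]]
    by (intro continuous_intros isCont_o2[of 0 "\<lambda>u. a + u" \<gamma>]) auto
  obtain \<epsilon>1 where \<epsilon>1: "\<epsilon>1 > 0" "\<And>u. \<bar>u\<bar> < \<epsilon>1 \<Longrightarrow> \<exists>v w. \<bar>w\<bar> \<le> (M * K) * \<bar>u\<bar> \<and>
      path_length 1 c2 (a + u) (b + v) = E2 \<and> path_length (- 1) c2 (b + v) (a + w) = 0"
    using compose_slopes[OF \<delta>1(1) \<delta>2(1) \<open>K > 0\<close> \<open>M > 0\<close> \<delta>1(2) \<delta>2(2)] by metis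
  have lower: "g a \<le> g (a + u)" if "\<bar>u\<bar> < \<epsilon>1" for u
  proof -
    have "\<exists>w. \<bar>w\<bar> \<le> (M * K) * \<bar>u\<bar> \<and> g (a + w) \<le> g (a + u)" if "\<bar>u\<bar> < \<epsilon>1" for u
      using \<epsilon>1(2)[OF that] ge le by (smt (verit))
    from contraction_le[OF cont \<open>0 \<le> M * K\<close> \<open>M * K < 1\<close> that this] show ?thesis
      by simp
  qed
  obtain \<epsilon>2 where \<epsilon>2: "\<epsilon>2 > 0" "\<And>u. \<bar>u\<bar> < \<epsilon>2 \<Longrightarrow> \<exists>v w. \<bar>w\<bar> \<le> (M * K) * \<bar>u\<bar> \<and>
      path_length (- 1) c1 (a + u) (b + v) = 0 \<and> path_length 1 c1 (b + v) (a + w) = E1"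
    using compose_slopes[OF \<delta>3(1) \<delta>4(1) \<open>K > 0\<close> \<open>M > 0\<close> \<delta>3(2) \<delta>4(2)] by metis
  have upper: "g (a + u) \<le> g a" if "\<bar>u\<bar> < \<epsilon>2" for u
  proof -
    have "\<exists>w. \<bar>w\<bar> \<le> (M * K) * \<bar>u\<bar> \<and> - g (a + w) \<le> - g (a + u)" if "\<bar>u\<bar> < \<epsilon>2" for u
      using \<epsilon>2(2)[OF that] ge le by (smt (verit))
    from contraction_le[OF continuous_minus[OF cont] \<open>0 \<le> M * K\<close> \<open>M * K < 1\<close> that this] show ?thesis
      by simp
  qed
  have "g s = g a" if "dist s a < min \<epsilon>1 \<epsilon>2" for s
    using lower[of "s - a"] upper[of "s - a"] that by (simp add: dist_real_def)
  moreover have "min \<epsilon>1 \<epsilon>2 > 0"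
    using \<epsilon>1(1) \<epsilon>2(1) by simp
  ultimately have "\<forall>\<^sub>F s in nhds a. g s = g a"
    unfolding eventually_nhds_metric by blast
  then show thesis
    by (rule that)
qed

lemma real_analytic_dist_power2: "real_analytic (\<lambda>t. (dist (\<gamma> t) p)\<^sup>2)"
proof -
  have "(dist (\<gamma> t) p)\<^sup>2 = (\<gamma> t $ 1 + - p $ 1) * (\<gamma> t $ 1 + - p $ 1) +
      (\<gamma> t $ 2 + - p $ 2) * (\<gamma> t $ 2 + - p $ 2)" for t
    by (simp add: dist_norm power2_norm_eq_inner inner_vec_def sum_2)
  then show ?thesis
    by (simp only:) (intro real_analytic_add real_analytic_mult real_analytic_const
        real_analytic_component analytic)
qed

text \<open>The sum of the distances is locally constant somewhere, hence constant along the analytic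
  boundary, which therefore lies on an ellipse. Conversely, each ray from \<open>c1\<close> meets both
  the boundary and the ellipse, and it meets the ellipse only once.\<close>

lemma focal_points_ellipse:
  assumes "focal_point \<Omega> \<gamma> c1" "focal_point \<Omega> \<gamma> c2" "c1 \<noteq> c2"
  shows "ellipse_with_foci (frontier \<Omega>) c1 c2"
proof -
  have c: "c1 \<in> \<Omega>" "c2 \<in> \<Omega>"
    using assms by (simp_all add: focal_point_def)
  obtain a where a: "\<forall>\<^sub>F s in nhds a. dist (\<gamma> s) c1 + dist (\<gamma> s) c2 = dist (\<gamma> a) c1 + dist (\<gamma> a) c2"
    using focal_sum_locally_constant[OF assms] by blast
  define s where "s = dist (\<gamma> a) c1 + dist (\<gamma> a) c2"
  have "s \<noteq> dist c1 c2"
  proof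
    assume "s = dist c1 c2"
    \<comment> \<open>In the degenerate case \<open>\<gamma> a\<close> would lie between two interior points.\<close>
    then have "\<gamma> a \<in> closed_segment c1 c2"
      by (simp add: s_def between dist_commute flip: between_mem_segment)
    then have "\<gamma> a \<in> \<Omega>"
      using closed_segment_subset[OF c convex_domain] by blast
    then show False
      using curve_neq by blast
  qed
  then have s: "s > dist c1 c2"
    using dist_triangle3[of c1 c2 "\<gamma> a"] by (simp add: s_def)
  define Q where "Q t = 4 * s\<^sup>2 * (dist (\<gamma> t) c2)\<^sup>2 +
    - 1 * ((s\<^sup>2 + (dist (\<gamma> t) c2)\<^sup>2 + - 1 * (dist (\<gamma> t) c1)\<^sup>2) *
      (s\<^sup>2 + (dist (\<gamma> t) c2)\<^sup>2 + - 1 * (dist (\<gamma> t) c1)\<^sup>2))" for t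
  have Q_iff: "Q t = 0 \<longleftrightarrow> dist (\<gamma> t) c1 + dist (\<gamma> t) c2 = s" for t
    unfolding ellipse_equation_polynomial[OF s] Q_def by (simp add: power2_eq_square)
  have "real_analytic Q"
    unfolding Q_def
    by (intro real_analytic_add real_analytic_mult real_analytic_const real_analytic_dist_power2)
  moreover have "\<forall>\<^sub>F t in nhds a. Q t = 0"
    using a unfolding Q_iff s_def .
  ultimately have "Q t = 0" for t
    by (rule real_analytic_eq_0)
  then have on: "dist p c1 + dist p c2 = s" if "p \<in> frontier \<Omega>" for p
    using Q_iff curve_onto[OF that] by metis
  have "p \<in> frontier \<Omega>" if p: "dist p c1 + dist p c2 = s" for p
  proof -
    have "p \<noteq> c1"
      using p s by auto
    then obtain k where "k > 0" and k: "c1 + k *\<^sub>R (p - c1) \<in> frontier \<Omega>"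
      using ray_to_frontier[OF bounded, of c1 "p - c1"] c(1) open_domain
      by (metis interior_open right_minus_eq)
    have "\<not> k < 1"
      using ellipse_ray_less[OF s p \<open>k > 0\<close>] on[OF k] by auto
    moreover have "\<not> k > 1"
      using ellipse_ray_less[OF s on[OF k], of "1 / k"] p \<open>k > 0\<close> by auto
    ultimately have "k = 1"
      by simp
    with k show ?thesis
      by simp
  qed
  with on have "frontier \<Omega> = {p. dist p c1 + dist p c2 = s}"
    by blast
  with s show ?thesis
    unfolding ellipse_with_foci_def by blast
qed

end

theorem theorem4p1:
  fixes \<Omega> :: "plane set" and L :: real and \<gamma> :: "real \<Rightarrow> plane"
  assumes "planar_domain \<Omega>"
    and "bounded \<Omega>"
    and "strictly_convex \<Omega>"
    and "analytic_unit_speed_boundary \<Omega> L \<gamma>"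
  shows "finite (focal_points_second_kind \<Omega> \<gamma>) \<and>
    card (focal_points_second_kind \<Omega> \<gamma>) \<le> 2 \<and>
    (card (focal_points_second_kind \<Omega> \<gamma>) = 2 \<longrightarrow>
      (\<exists>f1 f2. ellipse_with_foci (frontier \<Omega>) f1 f2 \<and> \<not> circular (frontier \<Omega>) \<and>
        focal_points_second_kind \<Omega> \<gamma> = {f1, f2}))"
proof -
  interpret analytic_oval \<Omega> L \<gamma>
    using assms by unfold_locales
  let ?F = "focal_points_second_kind \<Omega> \<gamma>"
  have frontier: "bounded (frontier \<Omega>)" "frontier \<Omega> \<noteq> {}"
    using compact_imp_bounded[OF compact_frontier_bounded[OF bounded]] curve_in_frontier by auto
  have ellipse: "ellipse_with_foci (frontier \<Omega>) f g" if "f \<in> ?F" "g \<in> ?F" "f \<noteq> g" for f g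
    using that by (intro focal_points_ellipse) (auto simp: focal_points_second_kind_def)
  have pair: "?F = {f, g}" if "f \<in> ?F" "g \<in> ?F" "f \<noteq> g" for f g
  proof -
    have "h = g" if "h \<in> ?F" "h \<noteq> f" for h
      using common_focus_unique[OF ellipse ellipse frontier, of f h g]
        \<open>f \<in> ?F\<close> \<open>g \<in> ?F\<close> \<open>f \<noteq> g\<close> that by blast
    then show ?thesis
      using that by blast
  qed
  show ?thesis
  proof (cases "\<exists>f g. f \<in> ?F \<and> g \<in> ?F \<and> f \<noteq> g")
    case True
    then obtain f g where fg: "f \<in> ?F" "g \<in> ?F" "f \<noteq> g"
      by blast
    have "\<not> circular (frontier \<Omega>)"
      using ellipse_not_circular[OF ellipse[OF fg] frontier fg(3)] .
    then show ?thesis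
      using ellipse[OF fg] pair[OF fg] fg(3) by auto
  next
    case False
    then have "?F = {} \<or> (\<exists>f. ?F = {f})"
      by blast
    then show ?thesis
      by auto
  qed
qed

end
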